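(* Let $(\tau, Z, \gamma, h)$ be an integrable Aristotelian structure on an $n$-dimensional manifold $M^n$, induced by a $\mathsf{G}_{\mathtt A}$-structure $\pi\colon P\to M^n$ with Ehresmann connection $\omega\in\Omega^1(P,\mathfrak{g}_{\mathtt A})$ and intrinsic torsion $\Theta=\mathrm{d}\vartheta+\omega\wedge\vartheta$. Let $\alpha\in\Omega^1(M^n)$ be the one-form satisfying $\mathrm{d}\tau=\tau\wedge\alpha$ and $\iota_Z\alpha=0$. Let $\bar Z\in\Gamma(TP)$ be the horizontal lift of $Z$ with respect to $\omega$, and let $\bar\Theta\in\Omega^2(P)$ be the two-form $\bar\Theta_u=\langle u(\Theta_u),\tau_{\pi(u)}\rangle$. Then $$\pi^*(\alpha\wedge\mathrm{d}\alpha)=\iota_{\bar Z}\bar\Theta\wedge\mathrm{d}^\omega\,\iota_{\bar Z}\bar\Theta ,$$ where $\mathrm{d}^\omega$ is the exterior covariant derivative induced by $\omega$ on basic (real-valued, $\mathsf{G}_{\mathtt A}$-invariant, horizontal) forms on $P$.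
   Context: An Aristotelian structure on $M^n$ is a quadruple $(\tau,Z,\gamma,h)$: a nowhere-vanishing one-form $\tau$ (clock form), a vector field $Z$ with $\iota_Z\tau=1$, a corank one positive-semidefinite symmetric tensor $\gamma\in\Gamma(\odot^2TM^n)$ with $\iota_\tau\gamma=0$, and a corank one positive-semidefinite symmetric tensor $h\in\Gamma(\odot^2T^*M^n)$ with $\iota_Zh=0$. It is integrable if $\tau\wedge\mathrm{d}\tau=0$, so that $\ker\tau$ is tangent to a codimension one foliation. When $\iota_Z\tau=1$ and $\tau\wedge\mathrm d\tau=0$, the one-form $\alpha$ with $\mathrm{d}\tau=\tau\wedge\alpha$ and $\iota_Z\alpha=0$ is $\alpha=\pounds_Z\tau$. The Godbillon-Vey class of the foliation is $[\alpha\wedge\mathrm{d}\alpha]\in H^3(M^n;\mathbb{R})$. The structure is equivalent to a reduction $\pi\colon P\to M^n$ of the frame bundle to the subgroup $\mathsf{G}_{\mathtt A}=\{\mathrm{diag}(1,\mathsf{A}) : \mathsf{A}\in\mathsf{O}(n-1)\}\subset\mathsf{GL}(n,\mathbb{R})$, with Lie algebra $\mathfrak{g}_{\mathtt A}$. A point $u\in P$ over $x$ is a frame $u\colon\mathbb{R}^n\to T_xM^n$. The soldering form $\vartheta\in\Omega^1(P,\mathbb{R}^n)$ is $\iota_{X_u}\vartheta_u=u^{-1}(\pi_*X_u)$. In $\omega\wedge\vartheta$ the Lie algebra acts on $\mathbb{R}^n$ through $\mathfrak{g}_{\mathtt A}\subset\mathfrak{gl}(n,\mathbb{R})$. Thus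 $u(\Theta_u)\in\wedge^2T_u^*P\otimes T_xM^n$, and $\langle\cdot,\cdot\rangle$ is the duality pairing of $T_xM^n$ with $T_x^*M^n$. *)

theory Defs
  imports "HOL-Analysis.Analysis"
begin

section \<open>Smooth maps between open subsets of normed spaces\<close>

text \<open>\<open>Ck k S f\<close>: all iterated directional derivatives of \<open>f\<close> up to order \<open>k\<close> exist on \<open>S\<close>
  and are continuous. It is only used for open \<open>S\<close>.\<close>

primrec Ck :: "nat \<Rightarrow> 'a::real_normed_vector set \<Rightarrow> ('a \<Rightarrow> 'b::real_normed_vector) \<Rightarrow> bool" where
  "Ck 0 S f \<longleftrightarrow> continuous_on S f"
| "Ck (Suc k) S f \<longleftrightarrow> (\<forall>x\<in>S. f differentiable (at x)) \<and>
     (\<forall>v. Ck k S (\<lambda>x. frechet_derivative f (at x) v))"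

definition smooth_on :: "'a::real_normed_vector set \<Rightarrow> ('a \<Rightarrow> 'b::real_normed_vector) \<Rightarrow> bool" where
  "smooth_on S f \<longleftrightarrow> (\<forall>k. Ck k S f)"


section \<open>Manifolds\<close>

text \<open>The points of a manifold are all points of a type \<open>'m\<close>, which carries the topology; the model
  space is a Euclidean space \<open>'e\<close>. A chart is a domain together with a coordinate map (whose values
  outside the domain are irrelevant).

  Besides the atlas, the structure records a preferred chart \<open>chart_at M x\<close> around each point
  \<open>x\<close>. The tangent space at \<open>x\<close> is represented by the model space \<open>'e\<close> itself: a tangent vector is
  given by its components in the preferred chart at \<open>x\<close>. No compatibility between preferred charts
  of different points is assumed, so sections of bundles are smooth when they are smooth after
  conversion to the coordinates of each chart of the atlas.\<close>

type_synonym ('m, 'e) chart = "'m set \<times> ('m \<Rightarrow> 'e)"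

abbreviation cdom :: "('m, 'e) chart \<Rightarrow> 'm set" where "cdom c \<equiv> fst c"
abbreviation cmap :: "('m, 'e) chart \<Rightarrow> 'm \<Rightarrow> 'e" where "cmap c \<equiv> snd c"
abbreviation crange :: "('m, 'e) chart \<Rightarrow> 'e set" where "crange c \<equiv> cmap c ` cdom c"
abbreviation cinv :: "('m, 'e) chart \<Rightarrow> 'e \<Rightarrow> 'm" where "cinv c \<equiv> inv_into (cdom c) (cmap c)"

record ('m, 'e) manifold =
  atlas :: "('m, 'e) chart set"
  chart_at :: "'m \<Rightarrow> ('m, 'e) chart"

locale smooth_manifold =
  fixes M :: "('m::{t2_space, second_countable_topology}, 'e::euclidean_space) manifold"
  assumes open_cdom: "c \<in> atlas M \<Longrightarrow> open (cdom c)"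
    and open_crange: "c \<in> atlas M \<Longrightarrow> open (crange c)"
    and homeomorphism_chart:
      "c \<in> atlas M \<Longrightarrow> homeomorphism (cdom c) (crange c) (cmap c) (cinv c)"
    and smooth_transition: "c \<in> atlas M \<Longrightarrow> c' \<in> atlas M \<Longrightarrow>
      smooth_on (cmap c ` (cdom c \<inter> cdom c')) (cmap c' \<circ> cinv c)"
    and chart_at_in_atlas: "chart_at M x \<in> atlas M"
    and chart_at_dom: "x \<in> cdom (chart_at M x)"

definition euclidean_manifold :: "('e::euclidean_space, 'e) manifold" where
  "euclidean_manifold = \<lparr>atlas = {(UNIV, \<lambda>x. x)}, chart_at = (\<lambda>_. (UNIV, \<lambda>x. x))\<rparr>"

definition prod_chart :: "('m, 'e) chart \<Rightarrow> ('k, 'f) chart \<Rightarrow> ('m \<times> 'k, 'e \<times> 'f) chart" where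
  "prod_chart c d = (cdom c \<times> cdom d, map_prod (cmap c) (cmap d))"

definition prod_manifold ::
  "('m, 'e) manifold \<Rightarrow> ('k, 'f) manifold \<Rightarrow> ('m \<times> 'k, 'e \<times> 'f) manifold" where
  "prod_manifold M N =
     \<lparr>atlas = {prod_chart c d | c d. c \<in> atlas M \<and> d \<in> atlas N},
      chart_at = (\<lambda>(x, y). prod_chart (chart_at M x) (chart_at N y))\<rparr>"

text \<open>Smoothness of a map on a subset \<open>S\<close> of a manifold: near each point of \<open>S\<close>, its coordinate
  expression is the restriction of a smooth map on an open set. For open \<open>S\<close>, and for embedded
  submanifolds \<open>S\<close>, this is smoothness in the usual sense.\<close>

definition smooth_map_on ::
  "('m, 'e::real_normed_vector) manifold \<Rightarrow> ('k, 'f::real_normed_vector) manifold \<Rightarrow>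
   'm set \<Rightarrow> ('m \<Rightarrow> 'k) \<Rightarrow> bool" where
  "smooth_map_on M N S f \<longleftrightarrow> (\<forall>p\<in>S.
     (let c = chart_at M p; d = chart_at N (f p) in
      \<exists>W F. open W \<and> cmap c p \<in> W \<and> W \<subseteq> crange c \<and> smooth_on W F \<and>
        (\<forall>q\<in>S \<inter> cdom c. cmap c q \<in> W \<longrightarrow> f q \<in> cdom d \<and> cmap d (f q) = F (cmap c q))))"

text \<open>The tangent map \<open>T\<^sub>pM \<rightarrow> T\<^bsub>f p\<^esub>N\<close>.\<close>

definition mderiv ::
  "('m, 'e::real_normed_vector) manifold \<Rightarrow> ('k, 'f::real_normed_vector) manifold \<Rightarrow>
   ('m \<Rightarrow> 'k) \<Rightarrow> 'm \<Rightarrow> 'e \<Rightarrow> 'f" where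
  "mderiv M N f p =
     frechet_derivative (cmap (chart_at N (f p)) \<circ> f \<circ> cinv (chart_at M p))
       (at (cmap (chart_at M p) p))"

text \<open>\<open>to_coord M c x\<close> sends a tangent vector at \<open>x\<close> to its components in the chart \<open>c\<close>;
  \<open>of_coord M c x\<close> is the inverse isomorphism.\<close>

definition to_coord ::
  "('m, 'e::real_normed_vector) manifold \<Rightarrow> ('m, 'e) chart \<Rightarrow> 'm \<Rightarrow> 'e \<Rightarrow> 'e" where
  "to_coord M c x =
     frechet_derivative (cmap c \<circ> cinv (chart_at M x)) (at (cmap (chart_at M x) x))"

definition of_coord ::
  "('m, 'e::real_normed_vector) manifold \<Rightarrow> ('m, 'e) chart \<Rightarrow> 'm \<Rightarrow> 'e \<Rightarrow> 'e" where
  "of_coord M c x = frechet_derivative (cmap (chart_at M x) \<circ> cinv c) (at (cmap c x))"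

definition smooth_vector_field ::
  "('m, 'e::real_normed_vector) manifold \<Rightarrow> ('m \<Rightarrow> 'e) \<Rightarrow> bool" where
  "smooth_vector_field M V \<longleftrightarrow>
     (\<forall>c\<in>atlas M. smooth_on (crange c) (\<lambda>y. to_coord M c (cinv c y) (V (cinv c y))))"


section \<open>Differential forms\<close>

text \<open>A form of degree 1, 2 or 3 with values in a vector space is a function of a point and of
  one, two or three tangent vectors at that point. The wedge product is normalised by
  \<open>(\<alpha> \<and> \<beta>)(X, Y) = \<alpha>(X) \<beta>(Y) - \<alpha>(Y) \<beta>(X)\<close> and the exterior derivative by
  \<open>d\<alpha>(X, Y) = X(\<alpha>(Y)) - Y(\<alpha>(X)) - \<alpha>([X, Y])\<close>.\<close>

type_synonym ('m, 'e, 'v) form1 = "'m \<Rightarrow> 'e \<Rightarrow> 'v"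
type_synonym ('m, 'e, 'v) form2 = "'m \<Rightarrow> 'e \<Rightarrow> 'e \<Rightarrow> 'v"
type_synonym ('m, 'e, 'v) form3 = "'m \<Rightarrow> 'e \<Rightarrow> 'e \<Rightarrow> 'e \<Rightarrow> 'v"

text \<open>The coordinate expression of a 1-form, i.e. its pull-back along the inverse of a chart.\<close>

definition form_in_chart ::
  "('m, 'e::real_normed_vector) manifold \<Rightarrow> ('m, 'e, 'v) form1 \<Rightarrow> ('m, 'e) chart \<Rightarrow>
   'e \<Rightarrow> 'e \<Rightarrow> 'v" where
  "form_in_chart M \<alpha> c y v = \<alpha> (cinv c y) (of_coord M c (cinv c y) v)"

definition smooth_form1 ::
  "('m, 'e::real_normed_vector) manifold \<Rightarrow> ('m, 'e, 'v::real_normed_vector) form1 \<Rightarrow> bool" where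
  "smooth_form1 M \<alpha> \<longleftrightarrow> (\<forall>x. linear (\<alpha> x)) \<and>
     (\<forall>c\<in>atlas M. \<forall>v. smooth_on (crange c) (\<lambda>y. form_in_chart M \<alpha> c y v))"

text \<open>The usual coordinate formula, evaluated in the preferred chart at \<open>x\<close>; for smooth forms
  every chart around \<open>x\<close> gives the same value.\<close>

definition ext_deriv ::
  "('m, 'e::real_normed_vector) manifold \<Rightarrow> ('m, 'e, 'v::real_normed_vector) form1 \<Rightarrow>
   ('m, 'e, 'v) form2" where
  "ext_deriv M \<alpha> x v w =
     (let c = chart_at M x in
      frechet_derivative (\<lambda>y. form_in_chart M \<alpha> c y w) (at (cmap c x)) v
      - frechet_derivative (\<lambda>y. form_in_chart M \<alpha> c y v) (at (cmap c x)) w)"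

definition wedge11 :: "('m, 'e, real) form1 \<Rightarrow> ('m, 'e, real) form1 \<Rightarrow> ('m, 'e, real) form2" where
  "wedge11 \<alpha> \<beta> x X Y = \<alpha> x X * \<beta> x Y - \<alpha> x Y * \<beta> x X"

definition wedge12 :: "('m, 'e, real) form1 \<Rightarrow> ('m, 'e, real) form2 \<Rightarrow> ('m, 'e, real) form3" where
  "wedge12 \<alpha> \<beta> x X Y W = \<alpha> x X * \<beta> x Y W - \<alpha> x Y * \<beta> x X W + \<alpha> x W * \<beta> x X Y"

text \<open>Wedge product of a matrix-valued and a vector-valued 1-form, through the action of matrices
  on vectors.\<close>

definition wedge_act ::
  "('m, 'e, real^'n^'n) form1 \<Rightarrow> ('m, 'e, real^'n) form1 \<Rightarrow> ('m, 'e, real^'n) form2" where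
  "wedge_act \<omega> \<theta> x X Y = \<omega> x X *v \<theta> x Y - \<omega> x Y *v \<theta> x X"

definition interior2 :: "('m \<Rightarrow> 'e) \<Rightarrow> ('m, 'e, 'v) form2 \<Rightarrow> ('m, 'e, 'v) form1" where
  "interior2 V \<beta> x X = \<beta> x (V x) X"

definition pullback3 ::
  "('p, 'f::real_normed_vector) manifold \<Rightarrow> ('m, 'e::real_normed_vector) manifold \<Rightarrow> ('p \<Rightarrow> 'm) \<Rightarrow>
   ('m, 'e, 'v) form3 \<Rightarrow> ('p, 'f, 'v) form3" where
  "pullback3 P M f \<eta> u X Y W =
     \<eta> (f u) (mderiv P M f u X) (mderiv P M f u Y) (mderiv P M f u W)"


section \<open>Aristotelian structures\<close>

definition psd_corank_one :: "('v::real_vector \<Rightarrow> 'v \<Rightarrow> real) \<Rightarrow> bool" where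
  "psd_corank_one b \<longleftrightarrow> bilinear b \<and> (\<forall>v w. b v w = b w v) \<and> (\<forall>v. 0 \<le> b v v) \<and>
     dim {v. \<forall>w. b v w = 0} = 1"

text \<open>The cotangent space at \<open>x\<close> is the dual \<open>'e \<Rightarrow>\<^sub>L real\<close> of the tangent space, so that
  \<open>\<gamma> x\<close> is a bilinear form on it. Smoothness of \<open>\<gamma>\<close> and \<open>h\<close> is smoothness of their components
  in each chart.\<close>

locale aristotelian_structure = smooth_manifold M
  for M :: "('m::{t2_space, second_countable_topology}, real^'n) manifold" +
  fixes \<tau> :: "('m, real^'n, real) form1"
    and Z :: "'m \<Rightarrow> real^'n"
    and \<gamma> :: "'m \<Rightarrow> ((real^'n) \<Rightarrow>\<^sub>L real) \<Rightarrow> ((real^'n) \<Rightarrow>\<^sub>L real) \<Rightarrow> real"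
    and h :: "'m \<Rightarrow> real^'n \<Rightarrow> real^'n \<Rightarrow> real"
  assumes smooth_\<tau>: "smooth_form1 M \<tau>"
    and \<tau>_nonzero: "\<exists>v. \<tau> x v \<noteq> 0"
    and smooth_Z: "smooth_vector_field M Z"
    and \<tau>_Z: "\<tau> x (Z x) = 1"
    and psd_\<gamma>: "psd_corank_one (\<gamma> x)"
    and smooth_\<gamma>: "c \<in> atlas M \<Longrightarrow> smooth_on (crange c) (\<lambda>y.
      \<gamma> (cinv c y) (Blinfun (\<lambda>v. to_coord M c (cinv c y) v $ i))
                   (Blinfun (\<lambda>v. to_coord M c (cinv c y) v $ j)))"
    and \<gamma>_\<tau>: "\<gamma> x (Blinfun (\<tau> x)) \<phi> = 0"
    and psd_h: "psd_corank_one (h x)"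
    and smooth_h: "c \<in> atlas M \<Longrightarrow> smooth_on (crange c) (\<lambda>y.
      h (cinv c y) (of_coord M c (cinv c y) (axis i 1)) (of_coord M c (cinv c y) (axis j 1)))"
    and h_Z: "h x (Z x) v = 0"

locale integrable_aristotelian_structure = aristotelian_structure +
  assumes integrable: "wedge12 \<tau> (ext_deriv M \<tau>) x X Y W = 0"


section \<open>The structure group and G-structures\<close>

text \<open>The matrices \<open>diag(1, A)\<close> with \<open>A \<in> O(n - 1)\<close>. The index type \<open>'n\<close> has \<open>n\<close> elements; \<open>i0\<close> is
  the one that plays the role of the first index.\<close>

definition G_A :: "'n::finite \<Rightarrow> (real^'n^'n) set" where
  "G_A i0 = {a. a $ i0 $ i0 = 1 \<and> (\<forall>i. i \<noteq> i0 \<longrightarrow> a $ i0 $ i = 0 \<and> a $ i $ i0 = 0) \<and>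
     (\<forall>i j. i \<noteq> i0 \<longrightarrow> j \<noteq> i0 \<longrightarrow>
        (\<Sum>k\<in>UNIV - {i0}. a $ k $ i * a $ k $ j) = (if i = j then 1 else 0))}"

text \<open>A curve in a matrix group \<open>G\<close> which passes through the identity with velocity \<open>\<xi>\<close>. These
  velocities form the Lie algebra of \<open>G\<close>, as its tangent space at the identity.\<close>

definition curve_at_one :: "(real^'n^'n) set \<Rightarrow> (real \<Rightarrow> real^'n^'n) \<Rightarrow> real^'n^'n \<Rightarrow> bool" where
  "curve_at_one G a \<xi> \<longleftrightarrow> (\<forall>t. a t \<in> G) \<and> a 0 = mat 1 \<and> (a has_vector_derivative \<xi>) (at 0)"

definition lie_algebra :: "(real^'n^'n) set \<Rightarrow> (real^'n^'n) set" where
  "lie_algebra G = {\<xi>. \<exists>a. curve_at_one G a \<xi>}"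

text \<open>A reduction of the frame bundle of \<open>M\<close> to a matrix group \<open>G\<close>: a principal \<open>G\<close>-bundle
  \<open>\<pi>: P \<rightarrow> M\<close> with right action \<open>act\<close>, together with a smooth \<open>G\<close>-equivariant map over \<open>M\<close> to the
  frame bundle, which regards \<open>u\<close> as the frame \<open>frame u: R^n \<rightarrow> T\<^bsub>\<pi> u\<^esub>M\<close>. This map is
  automatically injective, since \<open>G\<close> is transitive on the fibres of \<open>\<pi>\<close> and acts freely on frames.\<close>

locale frame_reduction = M: smooth_manifold M + P: smooth_manifold P
  for M :: "('m::{t2_space, second_countable_topology}, real^'n) manifold"
    and P :: "('p::{t2_space, second_countable_topology}, 'e::euclidean_space) manifold" +
  fixes G :: "(real^'n^'n) set"
    and \<pi> :: "'p \<Rightarrow> 'm"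
    and act :: "'p \<Rightarrow> real^'n^'n \<Rightarrow> 'p"
    and frame :: "'p \<Rightarrow> real^'n \<Rightarrow> real^'n"
  assumes smooth_proj: "smooth_map_on P M UNIV \<pi>"
    and smooth_act:
      "smooth_map_on (prod_manifold P euclidean_manifold) P (UNIV \<times> G) (\<lambda>(u, a). act u a)"
    and act_one: "act u (mat 1) = u"
    and act_mult: "a \<in> G \<Longrightarrow> b \<in> G \<Longrightarrow> act (act u a) b = act u (a ** b)"
    and proj_act: "a \<in> G \<Longrightarrow> \<pi> (act u a) = \<pi> u"
    and simply_transitive: "\<pi> u = \<pi> u' \<Longrightarrow> \<exists>!a. a \<in> G \<and> u' = act u a"
    \<comment> \<open>a local trivialisation \<open>(y, a) \<mapsto> act (s y) a\<close>, with inverse \<open>u \<mapsto> (\<pi> u, \<kappa> u)\<close>\<close>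
    and locally_trivial: "\<exists>U s \<kappa>. open U \<and> x \<in> U \<and>
      smooth_map_on M P U s \<and> (\<forall>y\<in>U. \<pi> (s y) = y) \<and>
      smooth_map_on P euclidean_manifold (\<pi> -` U) \<kappa> \<and>
      (\<forall>u\<in>\<pi> -` U. \<kappa> u \<in> G \<and> u = act (s (\<pi> u)) (\<kappa> u))"
    and linear_frame: "linear (frame u)"
    and bij_frame: "bij (frame u)"
    and frame_act: "a \<in> G \<Longrightarrow> frame (act u a) \<xi> = frame u (a *v \<xi>)"
    \<comment> \<open>smoothness of \<open>frame\<close> in the charts of the frame bundle induced by those of \<open>M\<close>\<close>
    and smooth_frame: "c \<in> atlas M \<Longrightarrow>
      smooth_map_on P euclidean_manifold (\<pi> -` cdom c) (\<lambda>u. to_coord M c (\<pi> u) (frame u \<xi>))"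

text \<open>The Aristotelian structure induced by a \<open>G\<^sub>A\<close>-structure: in a frame \<open>u\<close> of \<open>P\<close> with dual frame
  \<open>(e^i)\<close> it reads \<open>Z = e\<^bsub>i0\<^esub>\<close>, \<open>\<tau> = e^i0\<close>,
  \<open>\<gamma> = \<Sum>\<^bsub>i \<noteq> i0\<^esub> e\<^sub>i \<otimes> e\<^sub>i\<close>, \<open>h = \<Sum>\<^bsub>i \<noteq> i0\<^esub> e^i \<otimes> e^i\<close>.\<close>

definition induces_aristotelian ::
  "'n::finite \<Rightarrow> ('p \<Rightarrow> 'm) \<Rightarrow> ('p \<Rightarrow> real^'n \<Rightarrow> real^'n) \<Rightarrow> ('m, real^'n, real) form1 \<Rightarrow>
   ('m \<Rightarrow> real^'n) \<Rightarrow> ('m \<Rightarrow> ((real^'n) \<Rightarrow>\<^sub>L real) \<Rightarrow> ((real^'n) \<Rightarrow>\<^sub>L real) \<Rightarrow> real) \<Rightarrow>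
   ('m \<Rightarrow> real^'n \<Rightarrow> real^'n \<Rightarrow> real) \<Rightarrow> bool" where
  "induces_aristotelian i0 \<pi> frame \<tau> Z \<gamma> h \<longleftrightarrow> (\<forall>u.
     Z (\<pi> u) = frame u (axis i0 1) \<and>
     (\<forall>v. \<tau> (\<pi> u) v = inv (frame u) v $ i0) \<and>
     (\<forall>\<phi> \<psi>. \<gamma> (\<pi> u) \<phi> \<psi> = (\<Sum>i\<in>UNIV - {i0}.
        blinfun_apply \<phi> (frame u (axis i 1)) * blinfun_apply \<psi> (frame u (axis i 1)))) \<and>
     (\<forall>v w. h (\<pi> u) v w = (\<Sum>i\<in>UNIV - {i0}. inv (frame u) v $ i * inv (frame u) w $ i)))"


section \<open>Connections and torsion\<close>

text \<open>A connection form: \<open>\<omega>\<close> reproduces the generators of the fundamental vector fields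
  \<open>d/dt (u \<cdot> g t)\<close> at \<open>t = 0\<close>, and \<open>(R\<^sub>a)\<^sup>* \<omega> = Ad(a\<^sup>-\<^sup>1) \<omega>\<close>.\<close>

locale ehresmann_connection = frame_reduction M P G \<pi> act frame
  for M :: "('m::{t2_space, second_countable_topology}, real^'n) manifold"
    and P :: "('p::{t2_space, second_countable_topology}, 'e::euclidean_space) manifold"
    and G :: "(real^'n^'n) set"
    and \<pi> :: "'p \<Rightarrow> 'm"
    and act :: "'p \<Rightarrow> real^'n^'n \<Rightarrow> 'p"
    and frame :: "'p \<Rightarrow> real^'n \<Rightarrow> real^'n" +
  fixes \<omega> :: "('p, 'e, real^'n^'n) form1"
  assumes smooth_conn: "smooth_form1 P \<omega>"
    and conn_lie_algebra: "\<omega> u X \<in> lie_algebra G"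
    and conn_fundamental: "curve_at_one G g \<xi> \<Longrightarrow>
      \<omega> u (mderiv euclidean_manifold P (\<lambda>t::real. act u (g t)) 0 1) = \<xi>"
    and conn_equivariant: "a \<in> G \<Longrightarrow>
      \<omega> (act u a) (mderiv P P (\<lambda>u. act u a) u X) = matrix_inv a ** \<omega> u X ** a"

definition soldering_form ::
  "('m, real^'n) manifold \<Rightarrow> ('p, 'e::real_normed_vector) manifold \<Rightarrow> ('p \<Rightarrow> 'm) \<Rightarrow>
   ('p \<Rightarrow> real^'n \<Rightarrow> real^'n) \<Rightarrow> ('p, 'e, real^'n) form1" where
  "soldering_form M P \<pi> frame u X = inv (frame u) (mderiv P M \<pi> u X)"

definition torsion_form ::
  "('m, real^'n) manifold \<Rightarrow> ('p, 'e::real_normed_vector) manifold \<Rightarrow> ('p \<Rightarrow> 'm) \<Rightarrow>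
   ('p \<Rightarrow> real^'n \<Rightarrow> real^'n) \<Rightarrow> ('p, 'e, real^'n^'n) form1 \<Rightarrow> ('p, 'e, real^'n) form2" where
  "torsion_form M P \<pi> frame \<omega> u X Y =
     ext_deriv P (soldering_form M P \<pi> frame) u X Y
     + wedge_act \<omega> (soldering_form M P \<pi> frame) u X Y"

definition horizontal_lift ::
  "('m, 'k::real_normed_vector) manifold \<Rightarrow> ('p, 'e::real_normed_vector) manifold \<Rightarrow> ('p \<Rightarrow> 'm) \<Rightarrow>
   ('p, 'e, 'g::zero) form1 \<Rightarrow> ('m \<Rightarrow> 'k) \<Rightarrow> ('p \<Rightarrow> 'e) \<Rightarrow> bool" where
  "horizontal_lift M P \<pi> \<omega> Z Z' \<longleftrightarrow> smooth_vector_field P Z' \<and>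
     (\<forall>u. \<omega> u (Z' u) = 0 \<and> mderiv P M \<pi> u (Z' u) = Z (\<pi> u))"

text \<open>The projection of \<open>T\<^sub>uP\<close> onto the horizontal space \<open>ker \<omega>\<^sub>u\<close> along the vertical space, the
  kernel of the tangent map of \<open>\<pi>\<close>.\<close>

definition horizontal_part ::
  "('m, 'k::real_normed_vector) manifold \<Rightarrow> ('p, 'e::real_normed_vector) manifold \<Rightarrow> ('p \<Rightarrow> 'm) \<Rightarrow>
   ('p, 'e, 'g::zero) form1 \<Rightarrow> 'p \<Rightarrow> 'e \<Rightarrow> 'e" where
  "horizontal_part M P \<pi> \<omega> u X =
     (THE H. \<omega> u H = 0 \<and> mderiv P M \<pi> u (X - H) = 0)"

text \<open>The exterior covariant derivative \<open>d\<^sup>\<omega>\<beta> = d\<beta> \<circ> (hor \<times> hor)\<close>.\<close>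

definition cov_ext_deriv ::
  "('m, 'k::real_normed_vector) manifold \<Rightarrow> ('p, 'e::real_normed_vector) manifold \<Rightarrow> ('p \<Rightarrow> 'm) \<Rightarrow>
   ('p, 'e, 'g::zero) form1 \<Rightarrow> ('p, 'e, real) form1 \<Rightarrow> ('p, 'e, real) form2" where
  "cov_ext_deriv M P \<pi> \<omega> \<beta> u X Y =
     ext_deriv P \<beta> u (horizontal_part M P \<pi> \<omega> u X) (horizontal_part M P \<pi> \<omega> u Y)"

end

theory Submission
  imports Defs
begin

text \<open>The structure group fixes the first coordinate, so its Lie algebra has vanishing first row and
  \<open>\<omega> \<and> \<vartheta>\<close> does not contribute to the component of the torsion along \<open>\<tau>\<close>. The first component of
  \<open>\<vartheta>\<close> is \<open>\<pi>\<^sup>*\<tau>\<close>, hence that component of the torsion is \<open>d(\<pi>\<^sup>*\<tau>) = \<pi>\<^sup>*(\<tau> \<and> \<alpha>)\<close>, and contracting it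
  with the horizontal lift of \<open>Z\<close> gives \<open>\<pi>\<^sup>*\<alpha>\<close>. Since \<open>d(\<pi>\<^sup>*\<alpha>) = \<pi>\<^sup>*(d\<alpha>)\<close> only depends on the projections of
  its arguments, the horizontal projection in \<open>d\<^sup>\<omega>\<close> has no effect on it. That this projection is well
  defined rests on the fact that every vertical vector is fundamental.\<close>

section \<open>Smooth maps\<close>

lemma smooth_on_imp_continuous_on: "smooth_on S f \<Longrightarrow> continuous_on S f"
  unfolding smooth_on_def by (metis Ck.simps(1))

lemma smooth_on_imp_differentiable: "smooth_on S f \<Longrightarrow> x \<in> S \<Longrightarrow> f differentiable (at x)"
  unfolding smooth_on_def by (metis Ck.simps(2))

lemma smooth_on_frechet_derivative:
  "smooth_on S f \<Longrightarrow> smooth_on S (\<lambda>x. frechet_derivative f (at x) v)"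
  unfolding smooth_on_def by (metis Ck.simps(2))

lemma smooth_on_has_derivative:
  "smooth_on S f \<Longrightarrow> x \<in> S \<Longrightarrow> (f has_derivative frechet_derivative f (at x)) (at x)"
  using smooth_on_imp_differentiable frechet_derivative_works by blast

section \<open>Symmetry of second derivatives\<close>

lemma has_derivative_along_line:
  assumes "f differentiable (at (p + s *\<^sub>R v))"
  shows "((\<lambda>s. f (p + s *\<^sub>R v)) has_vector_derivative
    frechet_derivative f (at (p + s *\<^sub>R v)) v) (at s)"
proof -
  have "(f has_derivative frechet_derivative f (at (p + s *\<^sub>R v))) (at (p + s *\<^sub>R v))"
    using assms frechet_derivative_works by blast
  moreover have "((\<lambda>s. p + s *\<^sub>R v) has_vector_derivative v) (at s)"
    by (auto intro!: derivative_eq_intros)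
  ultimately show ?thesis
    using vector_derivative_diff_chain_within[of "\<lambda>s. p + s *\<^sub>R v" v s UNIV f]
    by (auto simp: comp_def intro: has_derivative_at_withinI)
qed

text \<open>The mean value theorem is applied twice, first in direction \<open>v\<close> and then in
  direction \<open>w\<close>. The left-hand side is symmetric in \<open>v\<close> and
  \<open>w\<close>, so exchanging their roles will compare the two mixed derivatives.\<close>

lemma second_difference:
  fixes f :: "'a::real_normed_vector \<Rightarrow> real"
  assumes f: "\<And>y. y \<in> S \<Longrightarrow> f differentiable (at y)"
    and f': "\<And>y. y \<in> S \<Longrightarrow> (\<lambda>y. frechet_derivative f (at y) v) differentiable (at y)"
    and S: "\<And>a b. 0 \<le> a \<Longrightarrow> a \<le> t \<Longrightarrow> 0 \<le> b \<Longrightarrow> b \<le> t \<Longrightarrow> x + a *\<^sub>R v + b *\<^sub>R w \<in> S"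
    and t: "0 < t"
  obtains a b where "0 < a" "a < t" "0 < b" "b < t"
    "f (x + t *\<^sub>R v + t *\<^sub>R w) - f (x + t *\<^sub>R v) - f (x + t *\<^sub>R w) + f x =
      t * t * frechet_derivative (\<lambda>y. frechet_derivative f (at y) v)
        (at (x + a *\<^sub>R v + b *\<^sub>R w)) w"
proof -
  let ?g = "\<lambda>y. frechet_derivative f (at y) v"
  \<comment> \<open>\<open>\<phi> t - \<phi> 0\<close> is the second difference, and the derivative
    of \<open>\<phi>\<close> is a difference of values of \<open>?g\<close> at points that differ by
    \<open>t *\<^sub>R w\<close>, ready for the second mean value step.\<close>
  define \<phi> where "\<phi> a = f (x + t *\<^sub>R w + a *\<^sub>R v) - f (x + a *\<^sub>R v)" for a
  have S': "x + t *\<^sub>R w + a *\<^sub>R v \<in> S" "x + a *\<^sub>R v \<in> S" if "0 \<le> a" "a \<le> t" for a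
    using S[of a t] S[of a 0] that t by (simp_all add: algebra_simps)
  have "(\<phi> has_real_derivative ?g (x + t *\<^sub>R w + a *\<^sub>R v) - ?g (x + a *\<^sub>R v)) (at a)"
    if "0 \<le> a" "a \<le> t" for a
    unfolding \<phi>_def has_real_derivative_iff_has_vector_derivative
    by (intro has_vector_derivative_diff has_derivative_along_line f S' that)
  then obtain a where a: "0 < a" "a < t"
    "\<phi> t - \<phi> 0 = (t - 0) * (?g (x + t *\<^sub>R w + a *\<^sub>R v) - ?g (x + a *\<^sub>R v))"
    using MVT2[of 0 t \<phi> "\<lambda>a. ?g (x + t *\<^sub>R w + a *\<^sub>R v) - ?g (x + a *\<^sub>R v)"] t by blast
  have "((\<lambda>b. ?g (x + a *\<^sub>R v + b *\<^sub>R w)) has_real_derivative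
      frechet_derivative ?g (at (x + a *\<^sub>R v + b *\<^sub>R w)) w) (at b)"
    if "0 \<le> b" "b \<le> t" for b
    unfolding has_real_derivative_iff_has_vector_derivative
    by (intro has_derivative_along_line f' S) (use a that in auto)
  then obtain b where b: "0 < b" "b < t"
    "?g (x + a *\<^sub>R v + t *\<^sub>R w) - ?g (x + a *\<^sub>R v + 0 *\<^sub>R w) =
      (t - 0) * frechet_derivative ?g (at (x + a *\<^sub>R v + b *\<^sub>R w)) w"
    using MVT2[of 0 t "\<lambda>b. ?g (x + a *\<^sub>R v + b *\<^sub>R w)"
        "\<lambda>b. frechet_derivative ?g (at (x + a *\<^sub>R v + b *\<^sub>R w)) w"] t by blast
  show thesis
    by (rule that[OF a(1,2) b(1,2)]) (use a(3) b(3) in \<open>simp add: \<phi>_def algebra_simps\<close>)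
qed

text \<open>Schwarz's argument: the same second difference over a small parallelogram is
  \<open>t * t\<close> times a value of either mixed derivative near \<open>x\<close>, and
  continuity brings both values close to those at \<open>x\<close>.\<close>

lemma frechet_derivative_commute_real:
  fixes f :: "'a::real_normed_vector \<Rightarrow> real"
  assumes S: "open S" "x \<in> S"
    and f: "\<And>y. y \<in> S \<Longrightarrow> f differentiable (at y)"
    and f': "\<And>y v. y \<in> S \<Longrightarrow> (\<lambda>y. frechet_derivative f (at y) v) differentiable (at y)"
    and f'': "\<And>v w. continuous_on S
      (\<lambda>x. frechet_derivative (\<lambda>y. frechet_derivative f (at y) v) (at x) w)"
  shows "frechet_derivative (\<lambda>y. frechet_derivative f (at y) v) (at x) w =
    frechet_derivative (\<lambda>y. frechet_derivative f (at y) w) (at x) v" (is "?A x = ?B x")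
proof (rule ccontr)
  assume ne: "?A x \<noteq> ?B x"
  \<comment> \<open>Half the gap: balls of radius \<open>e\<close> around \<open>?A x\<close> and
    \<open>?B x\<close> are disjoint.\<close>
  define e where "e = \<bar>?A x - ?B x\<bar> / 2"
  have e: "e > 0" using ne by (simp add: e_def)
  have "\<forall>\<^sub>F y in nhds x. dist (g y) (g x) < e" if "continuous_on S g" for g :: "'a \<Rightarrow> real"
    using that S e unfolding continuous_on_eq_continuous_at[OF S(1)] isCont_def
      tendsto_at_iff_tendsto_nhds by (blast intro: tendstoD)
  from this[OF f'', of v w] this[OF f'', of w v]
  have "\<forall>\<^sub>F y in nhds x. dist (?A y) (?A x) < e" "\<forall>\<^sub>F y in nhds x. dist (?B y) (?B x) < e"
    by simp_all
  moreover have "\<forall>\<^sub>F y in nhds x. y \<in> S" using S eventually_nhds by blast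
  ultimately have "\<forall>\<^sub>F y in nhds x. y \<in> S \<and> dist (?A y) (?A x) < e \<and> dist (?B y) (?B x) < e"
    by eventually_elim auto
  then obtain d where d: "d > 0"
    "\<And>y. dist y x < d \<Longrightarrow> y \<in> S \<and> dist (?A y) (?A x) < e \<and> dist (?B y) (?B x) < e"
    unfolding eventually_nhds_metric by blast
  \<comment> \<open>The summand 1 keeps \<open>N\<close> positive when \<open>v\<close> and
    \<open>w\<close> both vanish. With \<open>t = d / 2 / N\<close> the parallelogram stays inside
    the ball of radius \<open>d\<close>.\<close>
  define N where "N = norm v + norm w + 1"
  have N: "N > 0" unfolding N_def by (smt (verit) norm_ge_zero)
  define t where "t = d / 2 / N"
  have t: "t > 0" using d(1) N by (simp add: t_def)
  have "t * N = d / 2" using N by (simp add: t_def)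
  with d(1) have "t * N < d" by simp
  then have tN: "t * norm v + t * norm w < d" using t by (simp add: N_def algebra_simps)
  have near: "dist (x + a *\<^sub>R v + b *\<^sub>R w) x < d"
    if "0 \<le> a" "a \<le> t" "0 \<le> b" "b \<le> t" for a b
  proof -
    have "norm (a *\<^sub>R v + b *\<^sub>R w) \<le> a * norm v + b * norm w"
      using that by (intro norm_triangle_le) auto
    also have "\<dots> \<le> t * norm v + t * norm w"
      using that by (intro add_mono mult_right_mono) auto
    also have "\<dots> < d" by (rule tN)
    finally show ?thesis by (simp add: dist_norm add.assoc)
  qed
  have near': "dist (x + b *\<^sub>R w + a *\<^sub>R v) x < d"
    if "0 \<le> a" "a \<le> t" "0 \<le> b" "b \<le> t" for a b
    using near[OF that] by (simp add: algebra_simps)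
  obtain a b where 1: "0 < a" "a < t" "0 < b" "b < t"
    "f (x + t *\<^sub>R v + t *\<^sub>R w) - f (x + t *\<^sub>R v) - f (x + t *\<^sub>R w) + f x =
      t * t * ?A (x + a *\<^sub>R v + b *\<^sub>R w)"
    by (rule second_difference[of S f v t x w]) (use f f' near d t in auto)
  obtain a' b' where 2: "0 < a'" "a' < t" "0 < b'" "b' < t"
    "f (x + t *\<^sub>R w + t *\<^sub>R v) - f (x + t *\<^sub>R w) - f (x + t *\<^sub>R v) + f x =
      t * t * ?B (x + a' *\<^sub>R w + b' *\<^sub>R v)"
    by (rule second_difference[of S f w t x v]) (use f f' near' d t in auto)
  \<comment> \<open>The two second differences only list their middle terms in opposite
    order.\<close>
  have "t * t * ?A (x + a *\<^sub>R v + b *\<^sub>R w) = t * t * ?B (x + a' *\<^sub>R w + b' *\<^sub>R v)"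
    using 1(5) 2(5) by (simp add: algebra_simps)
  then have "?A (x + a *\<^sub>R v + b *\<^sub>R w) = ?B (x + a' *\<^sub>R w + b' *\<^sub>R v)"
    using t by simp
  moreover have "dist (?A (x + a *\<^sub>R v + b *\<^sub>R w)) (?A x) < e"
    using d near[of a b] 1 by simp
  moreover have "dist (?B (x + a' *\<^sub>R w + b' *\<^sub>R v)) (?B x) < e"
    using d near'[of b' a'] 2 by simp
  ultimately show False by (simp add: e_def dist_real_def abs_if split: if_splits)
qed

lemma frechet_derivative_inner_left:
  assumes "f differentiable (at x)"
  shows "frechet_derivative (\<lambda>y. f y \<bullet> b) (at x) v = frechet_derivative f (at x) v \<bullet> b"
proof -
  have "((\<lambda>y. f y \<bullet> b) has_derivative (\<lambda>v. frechet_derivative f (at x) v \<bullet> b)) (at x)"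
    using assms by (intro has_derivative_inner_left) (simp flip: frechet_derivative_works)
  then show ?thesis by (rule fun_cong[OF frechet_derivative_at[symmetric]])
qed

text \<open>Both sides choose from the same set of derivatives at \<open>x\<close>, so the equation
  holds even where the functions are not differentiable.\<close>

lemma frechet_derivative_cong_open:
  assumes "open S" "x \<in> S" "\<And>y. y \<in> S \<Longrightarrow> f y = g y"
  shows "frechet_derivative f (at x) = frechet_derivative g (at x)"
proof -
  have "(f has_derivative D) (at x) \<longleftrightarrow> (g has_derivative D) (at x)" for D
    using has_derivative_transform_within_open assms by metis
  then show ?thesis unfolding frechet_derivative_def by simp
qed

lemma differentiable_transform_open:
  assumes "open S" "x \<in> S" "f differentiable (at x)" "\<And>y. y \<in> S \<Longrightarrow> f y = g y"
  shows "g differentiable (at x)"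
proof -
  obtain D where "(f has_derivative D) (at x)"
    using assms(3) unfolding differentiable_def by blast
  then have "(g has_derivative D) (at x)"
    using has_derivative_transform_within_open assms by blast
  then show ?thesis unfolding differentiable_def by blast
qed

text \<open>Inner products with a fixed vector \<open>b\<close> reduce the claim to real-valued
  functions, and they separate vectors.\<close>

lemma frechet_derivative_commute:
  fixes f :: "'a::real_normed_vector \<Rightarrow> 'b::real_inner"
  assumes S: "open S" "x \<in> S" and f: "smooth_on S f"
  shows "frechet_derivative (\<lambda>y. frechet_derivative f (at y) v) (at x) w =
    frechet_derivative (\<lambda>y. frechet_derivative f (at y) w) (at x) v"
proof -
  note f' = smooth_on_frechet_derivative[OF f]
  have 1: "frechet_derivative (\<lambda>y. f y \<bullet> b) (at x) v = frechet_derivative f (at x) v \<bullet> b"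
    if "x \<in> S" for x v b
    using that f by (intro frechet_derivative_inner_left smooth_on_imp_differentiable)
  have 2: "frechet_derivative (\<lambda>y. frechet_derivative (\<lambda>y. f y \<bullet> b) (at y) v) (at x) w =
      frechet_derivative (\<lambda>y. frechet_derivative f (at y) v) (at x) w \<bullet> b"
    if "x \<in> S" for x v w b
  proof -
    have "frechet_derivative (\<lambda>y. frechet_derivative (\<lambda>y. f y \<bullet> b) (at y) v) (at x) =
        frechet_derivative (\<lambda>y. frechet_derivative f (at y) v \<bullet> b) (at x)"
      by (rule frechet_derivative_cong_open[OF S(1) that 1])
    then show ?thesis
      by (simp add: frechet_derivative_inner_left[OF smooth_on_imp_differentiable[OF f' that]])
  qed
  have "frechet_derivative (\<lambda>y. frechet_derivative f (at y) v) (at x) w \<bullet> b =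
      frechet_derivative (\<lambda>y. frechet_derivative f (at y) w) (at x) v \<bullet> b" for b
  proof -
    have "(\<lambda>y. f y \<bullet> b) differentiable (at y)" if "y \<in> S" for y
      using f that by (intro differentiable_inner smooth_on_imp_differentiable differentiable_const)
    moreover have "(\<lambda>y. frechet_derivative (\<lambda>y. f y \<bullet> b) (at y) v) differentiable (at y)"
      if "y \<in> S" for y v
    proof -
      have "(\<lambda>y. frechet_derivative f (at y) v \<bullet> b) differentiable (at y)"
        using f' that by (intro differentiable_inner smooth_on_imp_differentiable differentiable_const)
      then show ?thesis
        by (rule differentiable_transform_open[OF S(1) that]) (simp add: 1)
    qed
    moreover have "continuous_on S
        (\<lambda>x. frechet_derivative (\<lambda>y. frechet_derivative (\<lambda>y. f y \<bullet> b) (at y) v) (at x) w)" for v w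
    proof -
      have "continuous_on S (\<lambda>x. frechet_derivative (\<lambda>y. frechet_derivative f (at y) v) (at x) w \<bullet> b)"
        by (intro continuous_on_inner continuous_on_const smooth_on_imp_continuous_on
            smooth_on_frechet_derivative f)
      then show ?thesis using 2 by (simp cong: continuous_on_cong)
    qed
    ultimately have "frechet_derivative (\<lambda>y. frechet_derivative (\<lambda>y. f y \<bullet> b) (at y) v) (at x) w =
        frechet_derivative (\<lambda>y. frechet_derivative (\<lambda>y. f y \<bullet> b) (at y) w) (at x) v"
      by (intro frechet_derivative_commute_real[OF S])
    then show ?thesis by (simp add: 2[OF S(2)])
  qed
  then show ?thesis by (metis vector_eq_rdot)
qed

section \<open>Charts and coordinate changes\<close>

context smooth_manifold
begin

lemma cinv_cmap [simp]: "c \<in> atlas M \<Longrightarrow> q \<in> cdom c \<Longrightarrow> cinv c (cmap c q) = q"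
  using homeomorphism_chart homeomorphism_apply1 by blast

lemma inj_on_cmap: "c \<in> atlas M \<Longrightarrow> inj_on (cmap c) (cdom c)"
  by (metis cinv_cmap inj_on_def)

lemma continuous_on_cmap: "c \<in> atlas M \<Longrightarrow> continuous_on (cdom c) (cmap c)"
  using homeomorphism_chart homeomorphism_cont1 by blast

lemma open_image_cmap: "c \<in> atlas M \<Longrightarrow> open V \<Longrightarrow> open (cmap c ` (cdom c \<inter> V))"
  using homeomorphism_imp_open_map[OF homeomorphism_chart, of c "cdom c \<inter> V"] open_crange[of c]
  by (meson openin_open_Int openin_open_trans)

lemma open_vimage_cmap: "c \<in> atlas M \<Longrightarrow> open W \<Longrightarrow> open (cdom c \<inter> cmap c -` W)"
  using continuous_on_cmap continuous_open_preimage open_cdom by blast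

lemma transition_differentiable:
  assumes "c \<in> atlas M" "c' \<in> atlas M" "x \<in> cdom c" "x \<in> cdom c'"
  shows "(cmap c' \<circ> cinv c) differentiable (at (cmap c x))"
  using smooth_on_imp_differentiable[OF smooth_transition] assms by blast

lemma has_derivative_of_coord:
  assumes "c \<in> atlas M" "x \<in> cdom c"
  shows "((cmap (chart_at M x) \<circ> cinv c) has_derivative of_coord M c x) (at (cmap c x))"
  using transition_differentiable[OF assms(1) chart_at_in_atlas assms(2) chart_at_dom]
  unfolding of_coord_def frechet_derivative_works .

lemma has_derivative_to_coord:
  assumes "c \<in> atlas M" "x \<in> cdom c"
  shows "((cmap c \<circ> cinv (chart_at M x)) has_derivative to_coord M c x)
    (at (cmap (chart_at M x) x))"
  using transition_differentiable[OF chart_at_in_atlas assms(1) chart_at_dom assms(2)]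
  unfolding to_coord_def frechet_derivative_works .

text \<open>The two transition maps compose to the identity on the open image of the overlap; the
  chain rule and uniqueness of derivatives do the rest.\<close>

lemma has_derivative_transition_inverse:
  assumes c: "c \<in> atlas M" "x \<in> cdom c" and c': "c' \<in> atlas M" "x \<in> cdom c'"
    and D: "((cmap c' \<circ> cinv c) has_derivative D) (at (cmap c x))"
    and E: "((cmap c \<circ> cinv c') has_derivative E) (at (cmap c' x))"
  shows "E (D v) = v"
proof -
  have "((cmap c \<circ> cinv c') \<circ> (cmap c' \<circ> cinv c) has_derivative E \<circ> D) (at (cmap c x))"
    using D E c c' by (intro diff_chain_at) simp_all
  then have "((\<lambda>y. y) has_derivative E \<circ> D) (at (cmap c x))"
    by (rule has_derivative_transform_within_open[OF _ open_image_cmap[OF c(1) open_cdom[OF c'(1)]]])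
      (use c c' in auto)
  then show ?thesis
    using has_derivative_unique[OF has_derivative_ident] by (metis comp_apply)
qed

lemma to_coord_of_coord [simp]:
  "c \<in> atlas M \<Longrightarrow> x \<in> cdom c \<Longrightarrow> to_coord M c x (of_coord M c x v) = v"
  by (rule has_derivative_transition_inverse[OF _ _ chart_at_in_atlas chart_at_dom
        has_derivative_of_coord has_derivative_to_coord])

lemma of_coord_to_coord [simp]:
  "c \<in> atlas M \<Longrightarrow> x \<in> cdom c \<Longrightarrow> of_coord M c x (to_coord M c x v) = v"
  by (rule has_derivative_transition_inverse[OF chart_at_in_atlas chart_at_dom _ _
        has_derivative_to_coord has_derivative_of_coord])

lemma linear_of_coord: "c \<in> atlas M \<Longrightarrow> x \<in> cdom c \<Longrightarrow> linear (of_coord M c x)"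
  using has_derivative_linear has_derivative_of_coord by blast

lemma linear_to_coord: "c \<in> atlas M \<Longrightarrow> x \<in> cdom c \<Longrightarrow> linear (to_coord M c x)"
  using has_derivative_linear has_derivative_to_coord by blast

text \<open>A tangent vector is stored by its components in the preferred chart, and the transition
  from that chart to itself is the identity.\<close>

lemma of_coord_chart_at: "of_coord M (chart_at M x) x v = v"
proof -
  note c = chart_at_in_atlas[of x] chart_at_dom[of x]
  have "((\<lambda>y. y) has_derivative of_coord M (chart_at M x) x) (at (cmap (chart_at M x) x))"
    by (rule has_derivative_transform_within_open[OF has_derivative_of_coord[OF c]
          open_crange[OF c(1)]]) (use c in auto)
  then show ?thesis using has_derivative_unique[OF has_derivative_ident] by metis
qed

lemma linear_form_in_chart:
  assumes "smooth_form1 M \<alpha>" "c \<in> atlas M" "y \<in> crange c"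
  shows "linear (form_in_chart M \<alpha> c y)"
proof -
  have "cinv c y \<in> cdom c" by (rule inv_into_into[OF assms(3)])
  then have "linear (of_coord M c (cinv c y))" by (rule linear_of_coord[OF assms(2)])
  moreover have "linear (\<alpha> (cinv c y))" using assms(1) by (simp add: smooth_form1_def)
  ultimately show ?thesis
    unfolding form_in_chart_def using linear_compose[of _ "\<alpha> (cinv c y)"] by (simp add: comp_def)
qed

end

section \<open>Local representatives and pull-backs\<close>

lemma smooth_map_onE:
  assumes "smooth_map_on M N S f" "p \<in> S"
  obtains W F where "open W" "cmap (chart_at M p) p \<in> W" "W \<subseteq> crange (chart_at M p)" "smooth_on W F"
    "\<And>q. q \<in> S \<Longrightarrow> q \<in> cdom (chart_at M p) \<Longrightarrow> cmap (chart_at M p) q \<in> W \<Longrightarrow>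
      f q \<in> cdom (chart_at N (f p)) \<and> cmap (chart_at N (f p)) (f q) = F (cmap (chart_at M p) q)"
proof -
  obtain W F where "open W \<and> cmap (chart_at M p) p \<in> W \<and> W \<subseteq> crange (chart_at M p) \<and> smooth_on W F \<and>
    (\<forall>q\<in>S \<inter> cdom (chart_at M p). cmap (chart_at M p) q \<in> W \<longrightarrow>
      f q \<in> cdom (chart_at N (f p)) \<and> cmap (chart_at N (f p)) (f q) = F (cmap (chart_at M p) q))"
    using assms(1)[unfolded smooth_map_on_def Let_def, rule_format, OF assms(2)] by (elim exE)
  note WF = conjunct1[OF this] conjunct2[OF this]
  show thesis
    by (rule that[of W F]) (use WF in simp_all)
qed

text \<open>The charts \<open>c\<close> and \<open>d\<close> stay fixed while the point
  \<open>cinv c y\<close> varies over \<open>W\<close>, and each such point has its own preferred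
  chart. Hence tangent maps at these points must be converted by \<open>to_coord\<close> and
  \<open>of_coord\<close> before they can be compared with the derivative of
  \<open>F\<close>.\<close>

locale local_representative = M: smooth_manifold M + N: smooth_manifold N
  for M :: "('m::{t2_space, second_countable_topology}, 'e::euclidean_space) manifold"
    and N :: "('k::{t2_space, second_countable_topology}, 'f::euclidean_space) manifold" +
  fixes f :: "'m \<Rightarrow> 'k" and c :: "('m, 'e) chart" and d :: "('k, 'f) chart"
    and W :: "'e set" and F :: "'e \<Rightarrow> 'f"
  assumes c: "c \<in> atlas M" and d: "d \<in> atlas N"
    and W: "open W" "W \<subseteq> crange c" and F: "smooth_on W F"
    and rep: "y \<in> W \<Longrightarrow> f (cinv c y) \<in> cdom d \<and> cmap d (f (cinv c y)) = F y"
begin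

lemma cinv_dom: "y \<in> W \<Longrightarrow> cinv c y \<in> cdom c"
  by (rule inv_into_into[OF subsetD[OF W(2)]])

lemma cmap_cinv: "y \<in> W \<Longrightarrow> cmap c (cinv c y) = y"
  by (rule f_inv_into_f[OF subsetD[OF W(2)]])

lemma F_in_crange: "y \<in> W \<Longrightarrow> F y \<in> crange d"
  using rep by (metis image_eqI)

lemma cinv_F: "y \<in> W \<Longrightarrow> cinv d (F y) = f (cinv c y)"
  using rep N.cinv_cmap[OF d] by metis

text \<open>Near \<open>q\<close> the expression of \<open>f\<close> in the preferred charts is
  \<open>F\<close> between two chart changes, so the chain rule gives its derivative.\<close>

lemma has_derivative_mderiv:
  assumes y: "y \<in> W"
  defines "q \<equiv> cinv c y"
  shows "((cmap (chart_at N (f q)) \<circ> f \<circ> cinv (chart_at M q)) has_derivative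
    of_coord N d (f q) \<circ> frechet_derivative F (at y) \<circ> to_coord M c q)
      (at (cmap (chart_at M q) q))"
proof -
  let ?c' = "chart_at M q" and ?d' = "chart_at N (f q)"
  let ?T = "cmap c \<circ> cinv ?c'"
  have q: "q \<in> cdom c" "cmap c q = y" "q \<in> cdom ?c'" "f q \<in> cdom d" "cmap d (f q) = F y"
    using cinv_dom[OF y] cmap_cinv[OF y] M.chart_at_dom rep[OF y] unfolding q_def by blast+
  have "?T (cmap ?c' q) = y" using q M.chart_at_in_atlas by simp
  have "((cmap ?d' \<circ> cinv d) \<circ> F \<circ> ?T has_derivative
      of_coord N d (f q) \<circ> frechet_derivative F (at y) \<circ> to_coord M c q) (at (cmap ?c' q))"
    using \<open>?T _ = y\<close> N.has_derivative_of_coord[OF d q(4)] q(5)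
      M.has_derivative_to_coord[OF c q(1)] smooth_on_has_derivative[OF F y]
    by (intro diff_chain_at) simp_all
  \<comment> \<open>\<open>F\<close> represents \<open>f\<close> only over \<open>W\<close>, so the
    neighbourhood is cut down to points whose \<open>c\<close>-coordinates lie there.\<close>
  moreover have "open (cmap ?c' ` (cdom ?c' \<inter> (cdom c \<inter> cmap c -` W)))"
    using M.open_image_cmap M.chart_at_in_atlas M.open_vimage_cmap[OF c W(1)] by blast
  ultimately show ?thesis
  proof (rule has_derivative_transform_within_open)
    show "cmap ?c' q \<in> cmap ?c' ` (cdom ?c' \<inter> (cdom c \<inter> cmap c -` W))" using q y by auto
    fix z assume "z \<in> cmap ?c' ` (cdom ?c' \<inter> (cdom c \<inter> cmap c -` W))"
    then obtain r where r: "z = cmap ?c' r" "r \<in> cdom ?c'" "r \<in> cdom c" "cmap c r \<in> W" by auto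
    then show "((cmap ?d' \<circ> cinv d) \<circ> F \<circ> ?T) z = (cmap ?d' \<circ> f \<circ> cinv ?c') z"
      using cinv_F[OF r(4)] c M.chart_at_in_atlas by simp
  qed
qed

lemma mderiv_eq:
  assumes "y \<in> W"
  shows "mderiv M N f (cinv c y) (of_coord M c (cinv c y) v) =
    of_coord N d (f (cinv c y)) (frechet_derivative F (at y) v)"
  unfolding mderiv_def frechet_derivative_at[OF has_derivative_mderiv[OF assms], symmetric]
  by (simp add: M.to_coord_of_coord[OF c cinv_dom[OF assms]])

lemma linear_mderiv:
  assumes "y \<in> W"
  shows "linear (mderiv M N f (cinv c y))"
  unfolding mderiv_def frechet_derivative_at[OF has_derivative_mderiv[OF assms], symmetric]
  by (rule has_derivative_linear[OF has_derivative_mderiv[OF assms]])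

end

section \<open>Pull-back of one-forms and the exterior derivative\<close>

definition pullback1 ::
  "('p, 'f::real_normed_vector) manifold \<Rightarrow> ('m, 'e::real_normed_vector) manifold \<Rightarrow> ('p \<Rightarrow> 'm) \<Rightarrow>
   ('m, 'e, 'v) form1 \<Rightarrow> ('p, 'f, 'v) form1" where
  "pullback1 P M f \<alpha> u X = \<alpha> (f u) (mderiv P M f u X)"

text \<open>A product rule for evaluating a varying linear map at a varying vector. Only the maps
  with fixed argument are assumed differentiable; expanding the argument in the basis turns the
  evaluation into a finite sum of scalar multiples of these.\<close>

lemma has_derivative_linear_family:
  fixes A :: "'b::euclidean_space \<Rightarrow> 'c::euclidean_space \<Rightarrow> 'v::real_normed_vector"
  assumes W: "open W" "x \<in> W" and V: "open V" "\<And>y. y \<in> W \<Longrightarrow> F y \<in> V"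
    and A: "\<And>z. z \<in> V \<Longrightarrow> linear (A z)"
    and A': "\<And>v. (\<lambda>z. A z v) differentiable (at (F x))"
    and F: "(F has_derivative F') (at x)" and g: "(g has_derivative g') (at x)"
  shows "((\<lambda>y. A (F y) (g y)) has_derivative
    (\<lambda>v. frechet_derivative (\<lambda>z. A z (g x)) (at (F x)) (F' v) + A (F x) (g' v))) (at x)"
proof -
  define B where "B b = frechet_derivative (\<lambda>z. A z b) (at (F x))" for b
  have B: "((\<lambda>z. A z b) has_derivative B b) (at (F x))" for b
    using A' frechet_derivative_works unfolding B_def by blast
  have expand: "A z v = (\<Sum>b\<in>Basis. (v \<bullet> b) *\<^sub>R A z b)" if "z \<in> V" for z v
  proof -
    have "A z (\<Sum>b\<in>Basis. (v \<bullet> b) *\<^sub>R b) = (\<Sum>b\<in>Basis. (v \<bullet> b) *\<^sub>R A z b)"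
      using A[OF that] by (simp add: linear_sum linear_scale)
    then show ?thesis by (simp add: euclidean_representation)
  qed
  have "((\<lambda>z. \<Sum>b\<in>Basis. (g x \<bullet> b) *\<^sub>R A z b) has_derivative
      (\<lambda>v. \<Sum>b\<in>Basis. (g x \<bullet> b) *\<^sub>R B b v)) (at (F x))"
    by (intro has_derivative_sum has_derivative_scaleR_right B)
  then have "((\<lambda>z. A z (g x)) has_derivative (\<lambda>v. \<Sum>b\<in>Basis. (g x \<bullet> b) *\<^sub>R B b v)) (at (F x))"
    by (rule has_derivative_transform_within_open[OF _ V(1) V(2)[OF W(2)]]) (simp flip: expand)
  \<comment> \<open>The claimed formula contains the derivative with argument frozen at
    \<open>g x\<close>, so this derivative is expanded in the basis too.\<close>
  then have 1: "frechet_derivative (\<lambda>z. A z (g x)) (at (F x)) v = (\<Sum>b\<in>Basis. (g x \<bullet> b) *\<^sub>R B b v)" for v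
    by (rule fun_cong[OF frechet_derivative_at[symmetric]])
  have "((\<lambda>y. A (F y) b) has_derivative (\<lambda>v. B b (F' v))) (at x)" for b
    using diff_chain_at[OF F B] by (simp add: comp_def)
  then have "((\<lambda>y. \<Sum>b\<in>Basis. (g y \<bullet> b) *\<^sub>R A (F y) b) has_derivative
      (\<lambda>v. \<Sum>b\<in>Basis. (g x \<bullet> b) *\<^sub>R B b (F' v) + (g' v \<bullet> b) *\<^sub>R A (F x) b)) (at x)"
    by (intro has_derivative_sum has_derivative_scaleR has_derivative_inner_left g)
  then have "((\<lambda>y. A (F y) (g y)) has_derivative
      (\<lambda>v. \<Sum>b\<in>Basis. (g x \<bullet> b) *\<^sub>R B b (F' v) + (g' v \<bullet> b) *\<^sub>R A (F x) b)) (at x)"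
    by (rule has_derivative_transform_within_open[OF _ W]) (simp add: expand[OF V(2)])
  then show ?thesis
    by (simp add: 1 expand[OF V(2)[OF W(2)], of "g' _"] sum.distrib)
qed

lemma (in local_representative) form_in_chart_pullback1:
  "y \<in> W \<Longrightarrow> form_in_chart M (pullback1 M N f \<alpha>) c y v =
    form_in_chart N \<alpha> d (F y) (frechet_derivative F (at y) v)"
  by (simp add: form_in_chart_def pullback1_def mderiv_eq cinv_F)

lemma local_representative_at:
  assumes "smooth_manifold M" "smooth_manifold N" "smooth_map_on M N UNIV f"
  obtains W F where "local_representative M N f (chart_at M p) (chart_at N (f p)) W F"
    "cmap (chart_at M p) p \<in> W"
proof -
  interpret M: smooth_manifold M by fact
  interpret N: smooth_manifold N by fact
  let ?c = "chart_at M p"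
  note c = M.chart_at_in_atlas[of p]
  obtain W F where W: "open W" "cmap ?c p \<in> W" "W \<subseteq> crange ?c" "smooth_on W F" and
    eq: "\<And>q. q \<in> UNIV \<Longrightarrow> q \<in> cdom ?c \<Longrightarrow> cmap ?c q \<in> W \<Longrightarrow>
      f q \<in> cdom (chart_at N (f p)) \<and> cmap (chart_at N (f p)) (f q) = F (cmap ?c q)"
    by (rule smooth_map_onE[OF assms(3), of p]) auto
  have "local_representative M N f ?c (chart_at N (f p)) W F"
  proof
    fix y assume "y \<in> W"
    then obtain q where "y = cmap ?c q" "q \<in> cdom ?c" using W(3) by auto
    then show "f (cinv ?c y) \<in> cdom (chart_at N (f p)) \<and>
        cmap (chart_at N (f p)) (f (cinv ?c y)) = F y"
      using eq[of q] c \<open>y \<in> W\<close> by simp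
  qed (use W c N.chart_at_in_atlas in auto)
  then show thesis using that W by blast
qed

lemma linear_mderiv:
  assumes "smooth_manifold M" "smooth_manifold N" "smooth_map_on M N UNIV f"
  shows "linear (mderiv M N f p)"
proof -
  obtain W F where L: "local_representative M N f (chart_at M p) (chart_at N (f p)) W F"
    and p: "cmap (chart_at M p) p \<in> W" by (rule local_representative_at[OF assms])
  interpret L: local_representative M N f "chart_at M p" "chart_at N (f p)" W F by fact
  show ?thesis
    using L.linear_mderiv[OF p] by (simp add: L.c L.M.chart_at_dom)
qed

text \<open>At the centre of the preferred charts both coordinate conversions are the
  identity.\<close>

lemma (in local_representative) mderiv_at:
  assumes "cmap c p \<in> W" "c = chart_at M p" "d = chart_at N (f p)"
  shows "mderiv M N f p v = frechet_derivative F (at (cmap c p)) v"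
  using mderiv_eq[OF assms(1)] c M.chart_at_dom[of p]
  by (simp add: assms(2,3) M.of_coord_chart_at N.of_coord_chart_at)

text \<open>The second derivatives of the local representative of \<open>f\<close> cancel, being symmetric.\<close>

lemma ext_deriv_pullback1:
  fixes \<alpha> :: "('k::{t2_space, second_countable_topology}, 'f::euclidean_space,
    'v::real_normed_vector) form1"
    and M :: "('m::{t2_space, second_countable_topology}, 'e::euclidean_space) manifold"
  assumes "smooth_manifold M" "smooth_manifold N" "smooth_map_on M N UNIV f" "smooth_form1 N \<alpha>"
  shows "ext_deriv M (pullback1 M N f \<alpha>) p v w =
    ext_deriv N \<alpha> (f p) (mderiv M N f p v) (mderiv M N f p w)"
proof -
  let ?c = "chart_at M p" and ?d = "chart_at N (f p)"
  obtain W F where L: "local_representative M N f ?c ?d W F" and p: "cmap ?c p \<in> W"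
    by (rule local_representative_at[OF assms(1-3)])
  interpret L: local_representative M N f ?c ?d W F by fact
  let ?x = "cmap ?c p" and ?A = "form_in_chart N \<alpha> ?d"
  let ?F' = "\<lambda>y. frechet_derivative F (at y)"
  have Fx: "F ?x = cmap ?d (f p)"
    using L.rep[OF p] L.c L.M.chart_at_dom by simp
  \<comment> \<open>Product rule: the first summand differentiates the coefficients of \<alpha> and
    survives antisymmetrisation, the second carries the second derivative of
    \<open>F\<close>.\<close>
  have "frechet_derivative (\<lambda>y. form_in_chart M (pullback1 M N f \<alpha>) ?c y w) (at ?x) v =
      frechet_derivative (\<lambda>z. ?A z (?F' ?x w)) (at (F ?x)) (?F' ?x v)
      + ?A (F ?x) (frechet_derivative (\<lambda>y. ?F' y w) (at ?x) v)" for v w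
  proof -
    have "((\<lambda>y. ?A (F y) (?F' y w)) has_derivative
      (\<lambda>v. frechet_derivative (\<lambda>z. ?A z (?F' ?x w)) (at (F ?x)) (?F' ?x v)
        + ?A (F ?x) (frechet_derivative (\<lambda>y. ?F' y w) (at ?x) v))) (at ?x)"
    proof (rule has_derivative_linear_family[OF L.W(1) p L.N.open_crange[OF L.d]])
      show "(\<lambda>z. ?A z v) differentiable at (F ?x)" for v
        using assms(4) L.d unfolding smooth_form1_def
        by (intro smooth_on_imp_differentiable[OF _ L.F_in_crange[OF p]]) simp
    qed (fact L.F_in_crange L.N.linear_form_in_chart[OF assms(4) L.d]
        smooth_on_has_derivative[OF L.F p]
        smooth_on_has_derivative[OF smooth_on_frechet_derivative[OF L.F] p])+
    then have "((\<lambda>y. form_in_chart M (pullback1 M N f \<alpha>) ?c y w) has_derivative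
      (\<lambda>v. frechet_derivative (\<lambda>z. ?A z (?F' ?x w)) (at (F ?x)) (?F' ?x v)
        + ?A (F ?x) (frechet_derivative (\<lambda>y. ?F' y w) (at ?x) v))) (at ?x)"
      by (rule has_derivative_transform_within_open[OF _ L.W(1) p])
        (simp add: L.form_in_chart_pullback1)
    then show ?thesis by (rule fun_cong[OF frechet_derivative_at[symmetric]])
  qed
  moreover have "frechet_derivative (\<lambda>y. ?F' y w) (at ?x) v =
      frechet_derivative (\<lambda>y. ?F' y v) (at ?x) w"
    by (rule frechet_derivative_commute[OF L.W(1) p L.F])
  moreover have "mderiv M N f p v = ?F' ?x v" for v
    by (rule L.mderiv_at[OF p]) simp_all
  ultimately show ?thesis
    unfolding ext_deriv_def Let_def by (simp add: Fx)
qed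

section \<open>The soldering form\<close>

lemma differentiable_prod:
  fixes f :: "'i \<Rightarrow> 'a::real_normed_vector \<Rightarrow> real"
  assumes "\<And>i. i \<in> I \<Longrightarrow> f i differentiable (at x)"
  shows "(\<lambda>x. \<Prod>i\<in>I. f i x) differentiable (at x)"
proof -
  have "(f i has_derivative frechet_derivative (f i) (at x)) (at x)" if "i \<in> I" for i
    using assms[OF that] by (simp flip: frechet_derivative_works)
  from has_derivative_prod[OF this] show ?thesis by (rule differentiableI)
qed

lemma differentiable_det:
  fixes A :: "'a::real_normed_vector \<Rightarrow> real^'n^'n"
  assumes "\<And>i j. (\<lambda>x. A x $ i $ j) differentiable (at x)"
  shows "(\<lambda>x. det (A x)) differentiable (at x)"
  unfolding det_def
  by (intro differentiable_sum ballI differentiable_mult differentiable_const differentiable_prod assms)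
    simp

lemma differentiable_cart:
  fixes f :: "'a::real_normed_vector \<Rightarrow> real^'n"
  assumes "\<And>i. (\<lambda>x. f x $ i) differentiable (at x)"
  shows "f differentiable (at x)"
proof -
  have "(\<lambda>x. \<Sum>i\<in>UNIV. f x $ i *\<^sub>R (axis i 1 :: real^'n)) differentiable (at x)"
    by (intro differentiable_sum ballI differentiable_scaleR differentiable_const assms) simp
  moreover have "(\<Sum>i\<in>UNIV. f y $ i *\<^sub>R (axis i 1 :: real^'n)) = f y" for y
    using basis_expansion[of "f y"] by (simp add: scalar_mult_eq_scaleR)
  ultimately show ?thesis by simp
qed

lemma differentiable_cart_nth:
  fixes f :: "'a::real_normed_vector \<Rightarrow> real^'n"
  assumes "f differentiable (at x)"
  shows "(\<lambda>x. f x $ i) differentiable (at x)"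
  using differentiable_inner[OF assms differentiable_const[of "axis i 1"]] by (simp add: inner_axis)

text \<open>Cramer's rule writes the solution as a quotient of determinants, so its regularity
  follows from that of the coefficients and the right-hand side.\<close>

lemma differentiable_linear_system:
  fixes A :: "'a::real_normed_vector \<Rightarrow> real^'n^'n"
  assumes S: "open S" "x \<in> S"
    and A: "\<And>i j. (\<lambda>x. A x $ i $ j) differentiable (at x)" and b: "b differentiable (at x)"
    and det: "\<And>y. y \<in> S \<Longrightarrow> det (A y) \<noteq> 0" and g: "\<And>y. y \<in> S \<Longrightarrow> A y *v g y = b y"
  shows "g differentiable (at x)"
proof (rule differentiable_transform_open[OF S])
  show "(\<lambda>y. \<chi> k. det (\<chi> i j. if j = k then b y $ i else A y $ i $ j) / det (A y)) differentiable (at x)"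
  proof (rule differentiable_cart)
    fix k
    have "(\<lambda>y. det (\<chi> i j. if j = k then b y $ i else A y $ i $ j)) differentiable (at x)"
    proof (rule differentiable_det)
      fix i j
      show "(\<lambda>y. (\<chi> i j. if j = k then b y $ i else A y $ i $ j) $ i $ j) differentiable (at x)"
        by (cases "j = k") (simp_all add: A differentiable_cart_nth[OF b])
    qed
    then show "(\<lambda>y. (\<chi> k. det (\<chi> i j. if j = k then b y $ i else A y $ i $ j) / det (A y)) $ k)
        differentiable (at x)"
      using differentiable_det[of A x, OF A] det[OF S(2)] by (simp add: differentiable_divide)
  qed
  show "(\<chi> k. det (\<chi> i j. if j = k then b y $ i else A y $ i $ j) / det (A y)) = g y" if "y \<in> S" for y
    using cramer[OF det[OF that]] g[OF that] by simp
qed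

lemma euclidean_chart_at [simp]: "chart_at euclidean_manifold x = (UNIV, \<lambda>x. x)"
  by (simp add: euclidean_manifold_def)

context frame_reduction
begin

text \<open>\<open>smooth_frame\<close> speaks of points over \<open>cdom d\<close>. Intersecting
  its neighbourhood with the domain of a local representative of the projection keeps the base
  points there.\<close>

lemma frame_differentiable:
  fixes u :: 'p and \<xi> :: "real^'n"
  defines "d \<equiv> chart_at M (\<pi> u)" and "c \<equiv> chart_at P u"
  shows "(\<lambda>y. to_coord M d (\<pi> (cinv c y)) (frame (cinv c y) \<xi>)) differentiable (at (cmap c u))"
proof -
  have c: "c \<in> atlas P" "u \<in> cdom c" and d: "d \<in> atlas M" "\<pi> u \<in> cdom d"
    by (simp_all add: c_def d_def M.chart_at_in_atlas M.chart_at_dom P.chart_at_in_atlas P.chart_at_dom)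
  obtain W F where L: "local_representative P M \<pi> c d W F" and u: "cmap c u \<in> W"
    unfolding c_def d_def
    by (rule local_representative_at[OF P.smooth_manifold_axioms M.smooth_manifold_axioms smooth_proj])
  interpret L: local_representative P M \<pi> c d W F by fact
  obtain W' F' where W': "open W'" "cmap c u \<in> W'" "smooth_on W' F'"
    and F': "\<And>q. q \<in> \<pi> -` cdom d \<Longrightarrow> q \<in> cdom c \<Longrightarrow> cmap c q \<in> W' \<Longrightarrow>
      to_coord M d (\<pi> q) (frame q \<xi>) = F' (cmap c q)"
    using smooth_map_onE[OF smooth_frame[OF d(1), of \<xi>], of u] d(2) unfolding c_def[symmetric]
    by simp metis
  show ?thesis
  proof (rule differentiable_transform_open)
    show "open (W \<inter> W')" using L.W(1) W'(1) by (rule open_Int)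
    show "cmap c u \<in> W \<inter> W'" using u W'(2) by (rule IntI)
    show "F' differentiable (at (cmap c u))" using smooth_on_imp_differentiable W' by metis
    show "F' y = to_coord M d (\<pi> (cinv c y)) (frame (cinv c y) \<xi>)" if "y \<in> W \<inter> W'" for y
      using F'[of "cinv c y"] that L.rep[of y] L.cinv_dom[of y] L.cmap_cinv[of y] by simp
  qed
qed

text \<open>The soldering form involves the inverse frame, while smoothness is given for the frame
  itself. The relation \<open>frame u (\<theta> X) = d\<pi> X\<close> is, in coordinates, an
  invertible linear system with differentiable data, and the form is its solution.\<close>

lemma soldering_form_differentiable:
  "(\<lambda>y. form_in_chart P (soldering_form M P \<pi> frame) (chart_at P u) y w)
    differentiable (at (cmap (chart_at P u) u))"
proof -
  define c where "c = chart_at P u"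
  define d where "d = chart_at M (\<pi> u)"
  have c: "c \<in> atlas P" "u \<in> cdom c" and d: "d \<in> atlas M" "\<pi> u \<in> cdom d"
    by (simp_all add: c_def d_def M.chart_at_in_atlas M.chart_at_dom P.chart_at_in_atlas P.chart_at_dom)
  obtain W F where L: "local_representative P M \<pi> c d W F" and u: "cmap c u \<in> W"
    unfolding c_def d_def
    by (rule local_representative_at[OF P.smooth_manifold_axioms M.smooth_manifold_axioms smooth_proj])
  interpret L: local_representative P M \<pi> c d W F by fact
  let ?\<theta> = "soldering_form M P \<pi> frame"
  \<comment> \<open>The coefficient map of the linear system: the frame at the point with
    coordinates \<open>y\<close>, expressed in the fixed chart \<open>d\<close>.\<close>
  define E where "E y \<xi> = to_coord M d (\<pi> (cinv c y)) (frame (cinv c y) \<xi>)" for y \<xi>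
  have "(\<lambda>y. form_in_chart P ?\<theta> c y w) differentiable (at (cmap c u))"
  proof (rule differentiable_linear_system[OF L.W(1) u])
    show "(\<lambda>y. matrix (E y) $ i $ j) differentiable (at (cmap c u))" for i j
      using differentiable_cart_nth[OF frame_differentiable[of u "axis j 1"]]
      by (simp add: matrix_def E_def c_def d_def)
    show "(\<lambda>y. frechet_derivative F (at y) w) differentiable (at (cmap c u))"
      by (rule smooth_on_imp_differentiable[OF smooth_on_frechet_derivative[OF L.F] u])
    fix y assume y: "y \<in> W"
    let ?q = "cinv c y"
    have \<pi>q: "\<pi> ?q \<in> cdom d" using L.rep[OF y] by simp
    have "E y = to_coord M d (\<pi> ?q) \<circ> frame ?q" by (simp add: E_def fun_eq_iff)
    moreover have "inj (to_coord M d (\<pi> ?q))"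
      by (rule inj_on_inverseI[of _ "of_coord M d (\<pi> ?q)"])
        (rule M.of_coord_to_coord[OF d(1) \<pi>q])
    ultimately have E: "linear (E y)" "inj (E y)"
      using linear_compose[OF linear_frame M.linear_to_coord[OF d(1) \<pi>q]]
        inj_compose[OF _ bij_is_inj[OF bij_frame]] by simp_all
    then show "det (matrix (E y)) \<noteq> 0" by (simp add: det_nz_iff_inj)
    have "frame ?q (form_in_chart P ?\<theta> c y w) = of_coord M d (\<pi> ?q) (frechet_derivative F (at y) w)"
      by (simp add: form_in_chart_def soldering_form_def L.mderiv_eq[OF y]
          surj_f_inv_f[OF bij_is_surj[OF bij_frame]])
    then show "matrix (E y) *v form_in_chart P ?\<theta> c y w = frechet_derivative F (at y) w"
      by (simp add: fun_cong[OF matrix_vector_mul(2)[OF E(1)]] E_def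
          M.to_coord_of_coord[OF d(1) \<pi>q])
  qed
  then show ?thesis by (simp add: c_def)
qed

end


section \<open>Vertical vectors\<close>

lemma has_derivative_transform_nhds:
  assumes "(f has_derivative D) (at x)" "\<forall>\<^sub>F y in nhds x. f y = g y"
  shows "(g has_derivative D) (at x)"
proof -
  obtain S where "open S" "x \<in> S" "\<And>y. y \<in> S \<Longrightarrow> f y = g y"
    using assms(2) unfolding eventually_nhds by auto
  then show ?thesis using has_derivative_transform_within_open[OF assms(1)] by simp
qed

lemma has_derivative_eventually_in_open:
  assumes "(f has_derivative D) (at x)" "open W" "f x \<in> W"
  shows "\<forall>\<^sub>F y in nhds x. f y \<in> W"
proof -
  have "(f \<longlongrightarrow> f x) (nhds x)"
    using has_derivative_continuous[OF assms(1)]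
    by (simp add: continuous_at tendsto_at_iff_tendsto_nhds)
  then show ?thesis using assms(2,3) by (rule topological_tendstoD)
qed

lemma mderiv_curve:
  "mderiv euclidean_manifold P k t = frechet_derivative (\<lambda>s. cmap (chart_at P (k t)) (k s)) (at t)"
  by (simp add: mderiv_def comp_def inv_identity)

lemma curve_at_one_has_derivative:
  "curve_at_one G g \<xi> \<Longrightarrow> (g has_derivative (\<lambda>t. t *\<^sub>R \<xi>)) (at 0)"
  by (simp add: curve_at_one_def has_vector_derivative_def)

section \<open>The structure group and the infinitesimal action\<close>

context frame_reduction
begin

lemma inj_frame: "frame u \<xi> = frame u \<eta> \<Longrightarrow> \<xi> = \<eta>"
  by (rule injD[OF bij_is_inj[OF bij_frame]])

text \<open>The torsor property yields a matrix in \<open>G\<close> with \<open>u = act u a\<close>.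
  It fixes the frame of \<open>u\<close>, which is injective, so it is the identity. Any point
  \<open>u\<close> serves, since the type \<open>'p\<close> is inhabited.\<close>

lemma mat_1_in_G: "mat 1 \<in> G"
proof -
  fix u
  obtain a where a: "a \<in> G" "u = act u a" using simply_transitive[of u u] by auto
  have "a *v \<xi> = mat 1 *v \<xi>" for \<xi>
    by (rule inj_frame[of u]) (simp flip: frame_act[OF a(1)] a(2))
  then have "a = mat 1" by (simp add: matrix_eq)
  with a(1) show ?thesis by simp
qed

text \<open>Acting by \<open>a\<close> and then by \<open>b\<close> stays in the fibre, hence is the
  action of one element \<open>k\<close> of \<open>G\<close>; comparing frames identifies
  \<open>k\<close> with the product.\<close>

lemma mult_in_G:
  assumes "a \<in> G" "b \<in> G"
  shows "a ** b \<in> G"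
proof -
  fix u :: 'p
  have "\<pi> u = \<pi> (act (act u a) b)" using assms by (simp add: proj_act)
  then obtain k where k: "k \<in> G" "act (act u a) b = act u k"
    using simply_transitive by metis
  have "k *v \<xi> = (a ** b) *v \<xi>" for \<xi>
  proof (rule inj_frame[of u])
    have "frame u (k *v \<xi>) = frame (act (act u a) b) \<xi>" by (simp add: k(2) frame_act[OF k(1)])
    then show "frame u (k *v \<xi>) = frame u ((a ** b) *v \<xi>)"
      by (simp add: frame_act assms matrix_vector_mul_assoc)
  qed
  then have "k = a ** b" by (simp add: matrix_eq)
  with k(1) show ?thesis by simp
qed

text \<open>\<open>F\<close> is smooth on an open set of pairs whose second entry is any nearby
  matrix, and agrees with the action for entries in \<open>G\<close>. This allows the action to be
  differentiated along curves in \<open>G\<close>.\<close>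

lemma act_local:
  assumes "a \<in> G"
  obtains W F where "open W" "(cmap (chart_at P u) u, a) \<in> W" "smooth_on W F"
    "\<And>q b. q \<in> cdom (chart_at P u) \<Longrightarrow> b \<in> G \<Longrightarrow> (cmap (chart_at P u) q, b) \<in> W \<Longrightarrow>
      act q b \<in> cdom (chart_at P (act u a)) \<and>
      cmap (chart_at P (act u a)) (act q b) = F (cmap (chart_at P u) q, b)"
proof -
  have ch: "chart_at (prod_manifold P euclidean_manifold) (u, a) =
      (cdom (chart_at P u) \<times> UNIV, map_prod (cmap (chart_at P u)) (\<lambda>x. x))"
    by (simp add: prod_manifold_def prod_chart_def)
  show thesis
  proof (rule smooth_map_onE[OF smooth_act, of "(u, a)"])
    show "(u, a) \<in> UNIV \<times> G" using assms by simp
    fix W F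
    assume W: "open W" "cmap (chart_at (prod_manifold P euclidean_manifold) (u, a)) (u, a) \<in> W"
      "smooth_on W F"
      and F: "\<And>q. q \<in> UNIV \<times> G \<Longrightarrow> q \<in> cdom (chart_at (prod_manifold P euclidean_manifold) (u, a)) \<Longrightarrow>
        cmap (chart_at (prod_manifold P euclidean_manifold) (u, a)) q \<in> W \<Longrightarrow>
        (case q of (u, a) \<Rightarrow> act u a) \<in> cdom (chart_at P (case (u, a) of (u, a) \<Rightarrow> act u a)) \<and>
        cmap (chart_at P (case (u, a) of (u, a) \<Rightarrow> act u a)) (case q of (u, a) \<Rightarrow> act u a) =
          F (cmap (chart_at (prod_manifold P euclidean_manifold) (u, a)) q)"
    show thesis
    proof (rule that[of W F])
      show "act q b \<in> cdom (chart_at P (act u a)) \<and>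
          cmap (chart_at P (act u a)) (act q b) = F (cmap (chart_at P u) q, b)"
        if "q \<in> cdom (chart_at P u)" "b \<in> G" "(cmap (chart_at P u) q, b) \<in> W" for q b
        using F[of "(q, b)"] that by (simp add: ch)
    qed (use W in \<open>simp_all add: ch\<close>)
  qed
qed


lemma mderiv_fundamental:
  assumes "curve_at_one G g \<xi>"
    and "((\<lambda>t. cmap (chart_at P u) (act u (g t))) has_derivative (\<lambda>t. t *\<^sub>R w)) (at 0)"
  shows "mderiv euclidean_manifold P (\<lambda>t. act u (g t)) 0 1 = w"
proof -
  have "act u (g 0) = u" using assms(1) by (simp add: curve_at_one_def act_one)
  then show ?thesis
    using fun_cong[OF frechet_derivative_at[OF assms(2)], of 1] by (simp add: mderiv_curve)
qed

text \<open>\<open>D\<close> is the infinitesimal action at \<open>u\<close>: the derivative of the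
  local expression of the action at the identity, in the matrix direction. One \<open>D\<close>
  serves all curves, so the velocity of an orbit curve depends linearly on \<xi> alone.\<close>

lemma act_curve:
  fixes u :: 'p
  obtains D where "linear D"
    "\<And>g \<xi>. curve_at_one G g \<xi> \<Longrightarrow>
      ((\<lambda>t. cmap (chart_at P u) (act u (g t))) has_derivative (\<lambda>t. t *\<^sub>R D \<xi>)) (at 0) \<and>
      (\<forall>\<^sub>F t in nhds 0. act u (g t) \<in> cdom (chart_at P u))"
proof -
  let ?c = "chart_at P u"
  obtain W F where W: "open W" "(cmap ?c u, mat 1) \<in> W" "smooth_on W F"
    and F: "\<And>q b. q \<in> cdom ?c \<Longrightarrow> b \<in> G \<Longrightarrow> (cmap ?c q, b) \<in> W \<Longrightarrow>
      act q b \<in> cdom ?c \<and> cmap ?c (act q b) = F (cmap ?c q, b)"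
    using act_local[OF mat_1_in_G, of u] unfolding act_one by blast
  note dF = smooth_on_has_derivative[OF W(3,2)]
  let ?F' = "frechet_derivative F (at (cmap ?c u, mat 1))"
  have lin: "linear ?F'" by (rule has_derivative_linear[OF dF])
  show thesis
  proof (rule that[of "\<lambda>\<xi>. ?F' (0, \<xi>)"])
    have "linear (\<lambda>\<xi>::real^'n^'n. (0::'e, \<xi>))" by (rule linearI) simp_all
    from linear_compose[OF this lin] show "linear (\<lambda>\<xi>. ?F' (0, \<xi>))" by (simp add: comp_def)
    fix g \<xi> assume g: "curve_at_one G g \<xi>"
    have g0: "g 0 = mat 1" and gG: "g t \<in> G" for t using g by (simp_all add: curve_at_one_def)
    have dg: "((\<lambda>t. (cmap ?c u, g t)) has_derivative (\<lambda>t. (0, t *\<^sub>R \<xi>))) (at 0)"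
      by (intro has_derivative_Pair has_derivative_const curve_at_one_has_derivative[OF g])
    have ev: "\<forall>\<^sub>F t in nhds 0. (cmap ?c u, g t) \<in> W"
      by (rule has_derivative_eventually_in_open[OF dg W(1)]) (simp add: g0 W(2))
    have "((\<lambda>t. F (cmap ?c u, g t)) has_derivative (\<lambda>t. ?F' (0, t *\<^sub>R \<xi>))) (at 0)"
      using diff_chain_at[OF dg, of F ?F'] dF by (simp add: comp_def g0)
    moreover have "?F' (0, t *\<^sub>R \<xi>) = t *\<^sub>R ?F' (0, \<xi>)" for t
      using linear_scale[OF lin, of t "(0, \<xi>)"] by simp
    ultimately have "((\<lambda>t. F (cmap ?c u, g t)) has_derivative (\<lambda>t. t *\<^sub>R ?F' (0, \<xi>))) (at 0)"
      by simp
    moreover have "\<forall>\<^sub>F t in nhds 0. F (cmap ?c u, g t) = cmap ?c (act u (g t))"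
      using ev by eventually_elim (simp add: F[OF P.chart_at_dom gG])
    moreover have "\<forall>\<^sub>F t in nhds 0. act u (g t) \<in> cdom ?c"
      using ev by eventually_elim (simp add: F[OF P.chart_at_dom gG])
    ultimately show "((\<lambda>t. cmap ?c (act u (g t))) has_derivative (\<lambda>t. t *\<^sub>R ?F' (0, \<xi>))) (at 0) \<and>
        (\<forall>\<^sub>F t in nhds 0. act u (g t) \<in> cdom ?c)"
      by (simp add: has_derivative_transform_nhds)
  qed
qed

text \<open>The projection is constant along an orbit curve, so the chain rule and uniqueness of
  derivatives force the image of its velocity to vanish.\<close>

lemma fundamental_vertical:
  assumes g: "curve_at_one G g \<xi>"
  shows "mderiv P M \<pi> u (mderiv euclidean_manifold P (\<lambda>t. act u (g t)) 0 1) = 0"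
proof -
  let ?c = "chart_at P u" and ?d = "chart_at M (\<pi> u)"
  obtain D where D: "((\<lambda>t. cmap ?c (act u (g t))) has_derivative (\<lambda>t. t *\<^sub>R D \<xi>)) (at 0)"
    and dom: "\<forall>\<^sub>F t in nhds 0. act u (g t) \<in> cdom ?c"
    using act_curve[of u] g by metis
  obtain W F where L: "local_representative P M \<pi> ?c ?d W F" and u: "cmap ?c u \<in> W"
    by (rule local_representative_at[OF P.smooth_manifold_axioms M.smooth_manifold_axioms smooth_proj])
  interpret L: local_representative P M \<pi> ?c ?d W F by fact
  let ?F' = "frechet_derivative F (at (cmap ?c u))"
  have g0: "act u (g 0) = u" and gG: "g t \<in> G" for t
    using g by (simp_all add: curve_at_one_def act_one)
  have ev: "\<forall>\<^sub>F t in nhds 0. cmap ?c (act u (g t)) \<in> W"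
    by (rule has_derivative_eventually_in_open[OF D L.W(1)]) (simp add: g0 u)
  have "((\<lambda>t. F (cmap ?c (act u (g t)))) has_derivative (\<lambda>t. ?F' (t *\<^sub>R D \<xi>))) (at 0)"
    using diff_chain_at[OF D, of F ?F'] smooth_on_has_derivative[OF L.F u] by (simp add: comp_def g0)
  moreover have "\<forall>\<^sub>F t in nhds 0. F (cmap ?c (act u (g t))) = cmap ?d (\<pi> u)"
    using ev dom
  proof eventually_elim
    fix t assume "cmap ?c (act u (g t)) \<in> W" "act u (g t) \<in> cdom ?c"
    then show "F (cmap ?c (act u (g t))) = cmap ?d (\<pi> u)"
      using L.rep[of "cmap ?c (act u (g t))"] by (simp add: L.c proj_act[OF gG])
  qed
  ultimately have "((\<lambda>t::real. cmap ?d (\<pi> u)) has_derivative (\<lambda>t. ?F' (t *\<^sub>R D \<xi>))) (at 0)"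
    by (rule has_derivative_transform_nhds)
  from fun_cong[OF has_derivative_unique[OF this has_derivative_const], of 1]
  have "?F' (D \<xi>) = 0" by simp
  moreover have "mderiv euclidean_manifold P (\<lambda>t. act u (g t)) 0 1 = D \<xi>"
    by (rule mderiv_fundamental[OF g D])
  moreover have "mderiv P M \<pi> u (D \<xi>) = ?F' (D \<xi>)" by (rule L.mderiv_at[OF u]) simp_all
  ultimately show ?thesis by simp
qed

text \<open>In a local trivialisation \<open>(\<pi>, \<kappa>)\<close> a vertical vector is tangent to the curve obtained by
  freezing the base point and moving along \<open>\<kappa>\<close> only.\<close>

lemma vertical_fundamental:
  assumes v: "mderiv P M \<pi> u v = 0"
  obtains g \<xi> where "curve_at_one G g \<xi>" "mderiv euclidean_manifold P (\<lambda>t. act u (g t)) 0 1 = v"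
proof -
  define c where "c = chart_at P u"
  define d where "d = chart_at M (\<pi> u)"
  have c: "c \<in> atlas P" "u \<in> cdom c" and d: "d \<in> atlas M" "\<pi> u \<in> cdom d"
    by (simp_all add: c_def d_def M.chart_at_in_atlas M.chart_at_dom P.chart_at_in_atlas P.chart_at_dom)
  obtain U s \<kappa> where U: "open U" "\<pi> u \<in> U" and s: "smooth_map_on M P U s"
    and \<pi>s: "\<forall>y\<in>U. \<pi> (s y) = y"
    and \<kappa>: "smooth_map_on P euclidean_manifold (\<pi> -` U) \<kappa>"
    and triv: "\<forall>u\<in>\<pi> -` U. \<kappa> u \<in> G \<and> u = act (s (\<pi> u)) (\<kappa> u)"
    using locally_trivial[of "\<pi> u"] by (elim exE conjE)
  have \<kappa>G: "\<kappa> q \<in> G" and triv: "act (s (\<pi> q)) (\<kappa> q) = q" if "\<pi> q \<in> U" for q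
    using triv that by simp_all
  define p where "p = s (\<pi> u)"
  define e where "e = chart_at P p"
  have e: "e \<in> atlas P" "p \<in> cdom e" by (simp_all add: e_def P.chart_at_in_atlas P.chart_at_dom)
  note \<kappa>u = \<kappa>G[OF U(2)]
  have act_p: "act p (\<kappa> u) = u" by (simp add: p_def triv U(2))
  \<comment> \<open>\<open>b\<close> links the point \<open>p\<close> of the local section to
    \<open>u\<close>, so that curves issuing from \<open>p\<close> can be rewritten as orbit curves
    of \<open>u\<close>.\<close>
  obtain b where b: "b \<in> G" "p = act u b"
    using simply_transitive[of u p] \<pi>s U(2) unfolding p_def by metis

  \<comment> \<open>\<open>F1\<close>, \<open>F2\<close>, \<open>F3\<close> and \<open>F4\<close>
    represent the projection, the section, the fibre coordinate \<kappa> and the action. The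
    trivialisation then reads \<open>y = F4 (F2 (F1 y), F3 y)\<close> near
    \<open>cmap c u\<close>.\<close>
  obtain W1 F1 where L: "local_representative P M \<pi> c d W1 F1" and W1: "cmap c u \<in> W1"
    unfolding c_def d_def
    by (rule local_representative_at[OF P.smooth_manifold_axioms M.smooth_manifold_axioms smooth_proj])
  interpret L: local_representative P M \<pi> c d W1 F1 by fact
  obtain W2 F2 where W2: "open W2" "cmap d (\<pi> u) \<in> W2" "smooth_on W2 F2"
    and F2: "\<And>x. x \<in> U \<Longrightarrow> x \<in> cdom d \<Longrightarrow> cmap d x \<in> W2 \<Longrightarrow>
      s x \<in> cdom e \<and> cmap e (s x) = F2 (cmap d x)"
    using smooth_map_onE[OF s U(2)] unfolding d_def e_def p_def by metis
  obtain W3 F3 where W3: "open W3" "cmap c u \<in> W3" "smooth_on W3 F3"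
    and F3: "\<And>q. \<pi> q \<in> U \<Longrightarrow> q \<in> cdom c \<Longrightarrow> cmap c q \<in> W3 \<Longrightarrow> \<kappa> q = F3 (cmap c q)"
    using smooth_map_onE[OF \<kappa>, of u] U(2) unfolding c_def by (simp, metis)
  obtain W4 F4 where W4: "open W4" "(cmap e p, \<kappa> u) \<in> W4" "smooth_on W4 F4"
    and F4: "\<And>q a. q \<in> cdom e \<Longrightarrow> a \<in> G \<Longrightarrow> (cmap e q, a) \<in> W4 \<Longrightarrow>
      cmap c (act q a) = F4 (cmap e q, a)"
    using act_local[OF \<kappa>u, of p] unfolding c_def e_def act_p by metis

  let ?x = "cmap c u"
  let ?D1 = "frechet_derivative F1 (at ?x)" and ?D2 = "frechet_derivative F2 (at (F1 ?x))"
    and ?D3 = "frechet_derivative F3 (at ?x)" and ?D4 = "frechet_derivative F4 (at (cmap e p, \<kappa> u))"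
  have F1x: "F1 ?x = cmap d (\<pi> u)" using L.rep[OF W1] by (simp add: c)
  have F2x: "F2 (F1 ?x) = cmap e p" using F2[OF U(2) d(2) W2(2)] by (simp add: F1x p_def)
  have F3x: "F3 ?x = \<kappa> u" using F3[OF U(2) c(2) W3(2)] by simp
  have D1v: "?D1 v = 0"
    using L.mderiv_at[OF W1, of v] v by (simp add: c_def d_def)
  \<comment> \<open>A straight line in the chart with velocity \<open>v\<close>; verticality makes
    its projection, and the section along it, stationary to first order.\<close>
  define y where "y t = ?x + t *\<^sub>R v" for t
  have y0: "y 0 = ?x" by (simp add: y_def)
  have dy: "(y has_derivative (\<lambda>t. t *\<^sub>R v)) (at 0)"
    unfolding y_def by (auto intro!: derivative_eq_intros)
  have d1: "((\<lambda>t. F1 (y t)) has_derivative (\<lambda>t. ?D1 (t *\<^sub>R v))) (at 0)"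
    using diff_chain_at[OF dy, of F1 ?D1] smooth_on_has_derivative[OF L.F W1] by (simp add: comp_def y0)
  have "?D1 (t *\<^sub>R v) = 0" for t
    using linear_scale[OF has_derivative_linear[OF smooth_on_has_derivative[OF L.F W1]], of t v]
    by (simp add: D1v)
  with d1 have d1': "((\<lambda>t. F1 (y t)) has_derivative (\<lambda>t. 0)) (at 0)" by simp
  have d2: "((\<lambda>t. F2 (F1 (y t))) has_derivative (\<lambda>t. 0)) (at 0)"
  proof -
    have "(F2 has_derivative ?D2) (at (F1 ?x))"
      by (rule smooth_on_has_derivative[OF W2(3)]) (simp add: F1x W2(2))
    then show ?thesis
      using diff_chain_at[OF d1', of F2 ?D2] linear_0[OF has_derivative_linear, of F2 ?D2]
      by (simp add: comp_def y0)
  qed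
  define k where "k t = F3 (y t)" for t
  have k0: "k 0 = \<kappa> u" by (simp add: k_def y0 F3x)
  have lin3: "linear ?D3" by (rule has_derivative_linear[OF smooth_on_has_derivative[OF W3(3,2)]])
  have dk: "(k has_derivative (\<lambda>t. t *\<^sub>R ?D3 v)) (at 0)"
    using diff_chain_at[OF dy, of F3 ?D3] smooth_on_has_derivative[OF W3(3,2)]
    by (simp add: comp_def y0 k_def[abs_def] linear_scale[OF lin3])

  have ev: "\<forall>\<^sub>F t in nhds 0. k t \<in> G \<and> (cmap e p, k t) \<in> W4 \<and> y t = F4 (F2 (F1 (y t)), k t)"
  proof -
    have "\<forall>\<^sub>F t in nhds 0. y t \<in> W1"
      by (rule has_derivative_eventually_in_open[OF dy L.W(1)]) (simp add: y0 W1)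
    moreover have "\<forall>\<^sub>F t in nhds 0. y t \<in> W3"
      by (rule has_derivative_eventually_in_open[OF dy W3(1)]) (simp add: y0 W3)
    moreover have "\<forall>\<^sub>F t in nhds 0. F1 (y t) \<in> W2"
      by (rule has_derivative_eventually_in_open[OF d1 W2(1)]) (simp add: y0 F1x W2)
    \<comment> \<open>Membership in this open image, with injectivity of the chart, returns the base
      point to \<open>U\<close>, where the trivialisation is available.\<close>
    moreover have "\<forall>\<^sub>F t in nhds 0. F1 (y t) \<in> cmap d ` (cdom d \<inter> U)"
      by (rule has_derivative_eventually_in_open[OF d1 M.open_image_cmap[OF d(1) U(1)]])
        (use d U in \<open>simp add: y0 F1x\<close>)
    moreover have "\<forall>\<^sub>F t in nhds 0. (F2 (F1 (y t)), k t) \<in> W4"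
      by (rule has_derivative_eventually_in_open[OF has_derivative_Pair[OF d2 dk] W4(1)])
        (simp add: y0 F2x k0 W4)
    moreover have "\<forall>\<^sub>F t in nhds 0. (cmap e p, k t) \<in> W4"
      by (rule has_derivative_eventually_in_open[OF has_derivative_Pair[OF has_derivative_const dk] W4(1)])
        (simp add: k0 W4)
    ultimately show ?thesis
    proof eventually_elim
      case (elim t)
      define q where "q = cinv c (y t)"
      have q: "q \<in> cdom c" "cmap c q = y t" "\<pi> q \<in> cdom d" "cmap d (\<pi> q) = F1 (y t)"
        using L.cinv_dom[OF elim(1)] L.cmap_cinv[OF elim(1)] L.rep[OF elim(1)] by (simp_all add: q_def)
      have \<pi>q: "\<pi> q \<in> U"
        using elim(4) inj_onD[OF M.inj_on_cmap[OF d(1)] _ q(3)] q(4) by auto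
      have kq: "k t = \<kappa> q" using F3[OF \<pi>q q(1)] elim(2) by (simp add: q(2) k_def)
      have sq: "s (\<pi> q) \<in> cdom e" "cmap e (s (\<pi> q)) = F2 (F1 (y t))"
        using F2[OF \<pi>q q(3)] elim(3) by (simp_all add: q(4))
      have "cmap c (act (s (\<pi> q)) (\<kappa> q)) = F4 (cmap e (s (\<pi> q)), \<kappa> q)"
        by (rule F4[OF sq(1) \<kappa>G[OF \<pi>q]]) (use elim(5) in \<open>simp add: sq(2) kq\<close>)
      then have "y t = F4 (F2 (F1 (y t)), k t)" by (simp add: triv[OF \<pi>q] q(2) sq(2) kq)
      then show ?case using \<kappa>G[OF \<pi>q] elim(6) by (simp add: kq)
    qed
  qed
  have dF4: "(F4 has_derivative ?D4) (at (cmap e p, \<kappa> u))"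
    by (rule smooth_on_has_derivative[OF W4(3,2)])
  have "((\<lambda>t. F4 (F2 (F1 (y t)), k t)) has_derivative (\<lambda>t. ?D4 (0, t *\<^sub>R ?D3 v))) (at 0)"
    using diff_chain_at[OF has_derivative_Pair[OF d2 dk], of F4 ?D4] dF4
    by (simp add: comp_def y0 F2x k0)
  moreover have "\<forall>\<^sub>F t in nhds 0. F4 (F2 (F1 (y t)), k t) = y t"
    using ev by eventually_elim simp
  ultimately have "(y has_derivative (\<lambda>t. ?D4 (0, t *\<^sub>R ?D3 v))) (at 0)"
    by (rule has_derivative_transform_nhds)
  \<comment> \<open>Differentiating the trivialisation identity along the line: the base slot
    contributes 0, so \<open>v\<close> comes from the fibre slot alone.\<close>
  then have D4: "(\<lambda>t. ?D4 (0, t *\<^sub>R ?D3 v)) = (\<lambda>t. t *\<^sub>R v)"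
    using dy has_derivative_unique by blast

  \<comment> \<open>\<open>k t\<close> is known to lie in \<open>G\<close> only for small
    \<open>t\<close>, while \<open>curve_at_one\<close> asks for membership at every time; the value
    \<open>mat 1\<close> fills in elsewhere.\<close>
  define g where "g t = (if k t \<in> G then b ** k t else mat 1)" for t
  have gG: "g t \<in> G" for t by (simp add: g_def mult_in_G b mat_1_in_G)
  have act_g: "act u (g t) = act p (k t)" if "k t \<in> G" for t
    using that b by (simp add: g_def act_mult)
  have "act u (g 0) = u" using act_g[of 0] by (simp add: k0 \<kappa>u act_p)
  then have "g 0 = mat 1"
    using simply_transitive[of u u] gG[of 0] mat_1_in_G act_one[of u] by metis
  moreover have "(g has_vector_derivative b ** ?D3 v) (at 0)"
  proof -
    have "linear (\<lambda>a. b ** a)"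
      by (rule linearI) (simp_all add: matrix_matrix_mult_def vec_eq_iff sum.distrib sum_distrib_left algebra_simps)
    then have "bounded_linear (\<lambda>a. b ** a)" by (simp add: linear_linear)
    from bounded_linear.has_derivative[OF this dk]
    have "((\<lambda>t. b ** k t) has_derivative (\<lambda>t. t *\<^sub>R (b ** ?D3 v))) (at 0)"
      unfolding linear_scale[OF \<open>linear (\<lambda>a. b ** a)\<close>] .
    moreover have "\<forall>\<^sub>F t in nhds 0. b ** k t = g t"
      using ev by eventually_elim (simp add: g_def)
    ultimately show ?thesis
      unfolding has_vector_derivative_def by (rule has_derivative_transform_nhds)
  qed
  ultimately have g: "curve_at_one G g (b ** ?D3 v)" by (simp add: curve_at_one_def gG)
  \<comment> \<open>Now the base slot is frozen at \<open>cmap e p\<close>. The derivative is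
    unchanged, since the moving base slot was already stationary.\<close>
  have "((\<lambda>t. cmap c (act u (g t))) has_derivative (\<lambda>t. t *\<^sub>R v)) (at 0)"
  proof (rule has_derivative_transform_nhds)
    show "((\<lambda>t. F4 (cmap e p, k t)) has_derivative (\<lambda>t. t *\<^sub>R v)) (at 0)"
      using diff_chain_at[OF has_derivative_Pair[OF has_derivative_const dk], of F4 ?D4 "cmap e p"] dF4
      by (simp add: comp_def k0 D4)
    show "\<forall>\<^sub>F t in nhds 0. F4 (cmap e p, k t) = cmap c (act u (g t))"
      using ev by eventually_elim (simp add: act_g F4[OF e(2)])
  qed
  then show thesis
    using that[OF g] mderiv_fundamental[OF g] by (simp add: c_def)
qed

end

section \<open>The horizontal projection\<close>

context ehresmann_connection
begin

lemma linear_connection: "linear (\<omega> u)"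
  using smooth_conn by (simp add: smooth_form1_def)

lemma linear_mderiv_proj: "linear (mderiv P M \<pi> u)"
  by (rule linear_mderiv[OF P.smooth_manifold_axioms M.smooth_manifold_axioms smooth_proj])

text \<open>A vertical vector is fundamental and \<omega> returns its generator. A vanishing
  generator gives the zero vector because the infinitesimal action is linear.\<close>

lemma vertical_horizontal_zero:
  assumes "mderiv P M \<pi> u v = 0" "\<omega> u v = 0"
  shows "v = 0"
proof -
  obtain g \<xi> where g: "curve_at_one G g \<xi>" "mderiv euclidean_manifold P (\<lambda>t. act u (g t)) 0 1 = v"
    by (rule vertical_fundamental[OF assms(1)])
  have "\<xi> = 0" using conn_fundamental[OF g(1), of u] g(2) assms(2) by simp
  moreover obtain D where "linear D"
    "((\<lambda>t. cmap (chart_at P u) (act u (g t))) has_derivative (\<lambda>t. t *\<^sub>R D \<xi>)) (at 0)"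
    using act_curve[of u] g(1) by metis
  ultimately show ?thesis
    using mderiv_fundamental[OF g(1)] g(2) linear_0 by metis
qed

text \<open>This justifies the definite description in \<open>horizontal_part\<close>. The witness
  is \<open>X\<close> minus the fundamental vector generated by \<open>\<omega> u X\<close>.\<close>

lemma ex1_horizontal_part: "\<exists>!H. \<omega> u H = 0 \<and> mderiv P M \<pi> u (X - H) = 0"
proof -
  obtain g where g: "curve_at_one G g (\<omega> u X)"
    using conn_lie_algebra[of u X] unfolding lie_algebra_def by auto
  let ?V = "mderiv euclidean_manifold P (\<lambda>t. act u (g t)) 0 1"
  show ?thesis
  proof (rule ex1I)
    show "\<omega> u (X - ?V) = 0 \<and> mderiv P M \<pi> u (X - (X - ?V)) = 0"
      using conn_fundamental[OF g, of u] fundamental_vertical[OF g, of u]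
      by (simp add: linear_diff[OF linear_connection])
    fix H assume H: "\<omega> u H = 0 \<and> mderiv P M \<pi> u (X - H) = 0"
    \<comment> \<open>Two candidates differ by a vector that is both vertical and
      horizontal.\<close>
    have "(X - ?V) - H = 0"
    proof (rule vertical_horizontal_zero[of u])
      have "X - ?V - H = (X - H) - ?V" by simp
      then show "mderiv P M \<pi> u (X - ?V - H) = 0"
        using H fundamental_vertical[OF g, of u] by (simp only: linear_diff[OF linear_mderiv_proj]) simp
      show "\<omega> u (X - ?V - H) = 0"
        using H conn_fundamental[OF g, of u] by (simp add: linear_diff[OF linear_connection])
    qed
    then show "H = X - ?V" by simp
  qed
qed

lemma mderiv_horizontal_part: "mderiv P M \<pi> u (horizontal_part M P \<pi> \<omega> u X) = mderiv P M \<pi> u X"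
  using conjunct2[OF theI'[OF ex1_horizontal_part[of u X], folded horizontal_part_def]]
  by (simp add: linear_diff[OF linear_mderiv_proj])

lemma cov_ext_deriv_pullback1:
  assumes "smooth_form1 M \<alpha>"
  shows "cov_ext_deriv M P \<pi> \<omega> (pullback1 P M \<pi> \<alpha>) u X Y =
    ext_deriv M \<alpha> (\<pi> u) (mderiv P M \<pi> u X) (mderiv P M \<pi> u Y)"
  unfolding cov_ext_deriv_def
    ext_deriv_pullback1[OF P.smooth_manifold_axioms M.smooth_manifold_axioms smooth_proj assms]
  by (simp add: mderiv_horizontal_part)

end

section \<open>The torsion component along the clock form\<close>

text \<open>Along any curve in \<open>G_A i0\<close> the row \<open>i0\<close> is constant, so its
  velocity vanishes.\<close>

lemma lie_algebra_G_A_row: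
  assumes "\<xi> \<in> lie_algebra (G_A i0)"
  shows "(\<xi> *v w) $ i0 = 0"
proof -
  obtain a where a: "\<And>t. a t \<in> G_A i0" "(a has_vector_derivative \<xi>) (at 0)"
    using assms by (auto simp: lie_algebra_def curve_at_one_def)
  have "\<xi> $ i0 $ j = 0" for j
  proof -
    have "((\<lambda>t. a t $ i0 $ j) has_vector_derivative \<xi> $ i0 $ j) (at 0)"
      by (intro bounded_linear.has_vector_derivative[OF bounded_linear_vec_nth] a(2))
    moreover have "a t $ i0 $ j = (if j = i0 then 1 else 0)" for t
      using a(1)[of t] by (auto simp: G_A_def)
    ultimately have "((\<lambda>t::real. if j = i0 then 1 else 0) has_vector_derivative \<xi> $ i0 $ j) (at 0)"
      by simp
    then show ?thesis
      using vector_derivative_unique_at[OF _ has_vector_derivative_const] by blast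
  qed
  then show ?thesis by (simp add: matrix_vector_mult_def)
qed

text \<open>A component is an inner product with a basis vector and so passes through the
  derivative. Differentiability enters because \<open>frechet_derivative\<close> is an arbitrary
  choice where no derivative exists.\<close>

lemma ext_deriv_nth:
  fixes \<theta> :: "('m, 'e::real_normed_vector, real^'n) form1"
  assumes "\<And>w. (\<lambda>y. form_in_chart M \<theta> (chart_at M x) y w) differentiable
    (at (cmap (chart_at M x) x))"
  shows "ext_deriv M \<theta> x v w $ i = ext_deriv M (\<lambda>x X. \<theta> x X $ i) x v w"
  using frechet_derivative_inner_left[OF assms, where b = "axis i 1"]
  by (simp add: ext_deriv_def Let_def form_in_chart_def inner_axis)

lemma torsion_form_clock_component:
  assumes "ehresmann_connection M P (G_A i0) \<pi> act frame \<omega>"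
    and "induces_aristotelian i0 \<pi> frame \<tau> Z \<gamma> h"
  shows "\<tau> (\<pi> u) (frame u (torsion_form M P \<pi> frame \<omega> u X Y)) =
    ext_deriv P (pullback1 P M \<pi> \<tau>) u X Y"
proof -
  interpret ehresmann_connection M P "G_A i0" \<pi> act frame \<omega> by fact
  have \<tau>: "\<tau> (\<pi> u) v = inv (frame u) v $ i0" for u v
    using assms(2) by (simp add: induces_aristotelian_def)
  have "\<tau> (\<pi> u) (frame u (torsion_form M P \<pi> frame \<omega> u X Y)) =
      torsion_form M P \<pi> frame \<omega> u X Y $ i0"
    by (simp add: \<tau> inv_f_f[OF bij_is_inj[OF bij_frame]])
  \<comment> \<open>Both terms of the wedge product apply a value of \<omega> to a vector, and the
    row \<open>i0\<close> of such a value is zero.\<close>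
  also have "\<dots> = ext_deriv P (soldering_form M P \<pi> frame) u X Y $ i0"
    by (simp add: torsion_form_def wedge_act_def lie_algebra_G_A_row[OF conn_lie_algebra])
  also have "\<dots> = ext_deriv P (\<lambda>u X. soldering_form M P \<pi> frame u X $ i0) u X Y"
    by (rule ext_deriv_nth[OF soldering_form_differentiable])
  also have "(\<lambda>u X. soldering_form M P \<pi> frame u X $ i0) = pullback1 P M \<pi> \<tau>"
    by (simp add: fun_eq_iff soldering_form_def pullback1_def \<tau>)
  finally show ?thesis .
qed

section \<open>The Godbillon-Vey form expressed through torsion\<close>

theorem proposition3p22:
  fixes M :: "('m::{t2_space, second_countable_topology}, real^'n) manifold"
    and P :: "('p::{t2_space, second_countable_topology}, 'e::euclidean_space) manifold"
    and i0 :: 'n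
    and \<tau> :: "('m, real^'n, real) form1"
    and Z :: "'m \<Rightarrow> real^'n"
    and \<gamma> :: "'m \<Rightarrow> ((real^'n) \<Rightarrow>\<^sub>L real) \<Rightarrow> ((real^'n) \<Rightarrow>\<^sub>L real) \<Rightarrow> real"
    and h :: "'m \<Rightarrow> real^'n \<Rightarrow> real^'n \<Rightarrow> real"
    and \<pi> :: "'p \<Rightarrow> 'm"
    and act :: "'p \<Rightarrow> real^'n^'n \<Rightarrow> 'p"
    and frame :: "'p \<Rightarrow> real^'n \<Rightarrow> real^'n"
    and \<omega> :: "('p, 'e, real^'n^'n) form1"
    and \<Theta> :: "('p, 'e, real^'n) form2"
    and \<alpha> :: "('m, real^'n, real) form1"
    and Zbar :: "'p \<Rightarrow> 'e"
    and \<Theta>bar :: "('p, 'e, real) form2"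
  assumes "integrable_aristotelian_structure M \<tau> Z \<gamma> h"
    and "frame_reduction M P (G_A i0) \<pi> act frame"
    and "induces_aristotelian i0 \<pi> frame \<tau> Z \<gamma> h"
    and "ehresmann_connection M P (G_A i0) \<pi> act frame \<omega>"
    and "\<Theta> = torsion_form M P \<pi> frame \<omega>"
    and "smooth_form1 M \<alpha>"
    and "ext_deriv M \<tau> = wedge11 \<tau> \<alpha>"
    and "\<forall>x. \<alpha> x (Z x) = 0"
    and "horizontal_lift M P \<pi> \<omega> Z Zbar"
    and "\<Theta>bar = (\<lambda>u X Y. \<tau> (\<pi> u) (frame u (\<Theta> u X Y)))"
  shows "pullback3 P M \<pi> (wedge12 \<alpha> (ext_deriv M \<alpha>)) =
    wedge12 (interior2 Zbar \<Theta>bar) (cov_ext_deriv M P \<pi> \<omega> (interior2 Zbar \<Theta>bar))"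
proof -
  interpret ehresmann_connection M P "G_A i0" \<pi> act frame \<omega> by fact
  interpret A: integrable_aristotelian_structure M \<tau> Z \<gamma> h by fact
  have Zbar: "mderiv P M \<pi> u (Zbar u) = Z (\<pi> u)" for u
    using assms(9) by (simp add: horizontal_lift_def)
  \<comment> \<open>The torsion component is the exterior derivative of the pulled-back \<tau>,
    hence the pull-back of the exterior derivative of \<tau>.\<close>
  have "\<Theta>bar u X Y = wedge11 \<tau> \<alpha> (\<pi> u) (mderiv P M \<pi> u X) (mderiv P M \<pi> u Y)" for u X Y
    unfolding assms(5,10) torsion_form_clock_component[OF assms(4,3)]
      ext_deriv_pullback1[OF P.smooth_manifold_axioms M.smooth_manifold_axioms smooth_proj A.smooth_\<tau>]
      assms(7) ..
  \<comment> \<open>\<open>Zbar\<close> projects to \<open>Z\<close>; with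
    \<open>\<tau> x (Z x) = 1\<close> and \<open>\<alpha> x (Z x) = 0\<close> only the term \<alpha>
    of the wedge product remains.\<close>
  then have \<iota>: "interior2 Zbar \<Theta>bar = pullback1 P M \<pi> \<alpha>"
    by (simp add: assms(8) fun_eq_iff interior2_def wedge11_def pullback1_def Zbar A.\<tau>_Z)
  show ?thesis
    unfolding \<iota> by (simp add: fun_eq_iff pullback3_def wedge12_def pullback1_def
        cov_ext_deriv_pullback1[OF assms(6), unfolded fun_eq_iff])
qed

end
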